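(* Let $R:(\mathcal C\times\mathcal C)^{op}\to\mathsf{Pos}$ be an extensional relational doctrine with quotients and let $\mathcal G$ be a full subcategory of $\mathcal C$. The following are equivalent: (1) $\mathcal G$ is an $R$-projective cover; (2) for every monad $\mathbb T=\langle T,\eta,\mu\rangle$ on $R$ in $\mathbf{EQRD}$, the category $\mathcal G_{\widehat{\mathbb T}}$ is an $R^{\mathbb T}$-projective cover.
   Context: A relational doctrine consists of a category $\mathcal C$ (its base) and a functor $R:(\mathcal C\times\mathcal C)^{op}\to\mathsf{Pos}$ (posets and monotone maps; $R_{f,g}:R(X,Y)\to R(A,B)$ for $f:A\to X$, $g:B\to Y$), together with monotone maps $;:R(X,Y)\times R(Y,Z)\to R(X,Z)$, elements $\mathsf d_X\in R(X,X)$ and monotone maps $(-)^\bot:R(X,Y)\to R(Y,X)$ such that $\alpha;(\beta;\gamma)=(\alpha;\beta);\gamma$, $\mathsf d_X;\alpha=\alpha=\alpha;\mathsf d_Y$, $(\alpha;\beta)^\bot=\beta^\bot;\alpha^\bot$, $\mathsf d_X^\bot=\mathsf d_X$, $\alpha^{\bot\bot}=\alpha$, and $R_{f,g}(\alpha);R_{g,h}(\beta)\le R_{f,h}(\alpha;\beta)$, $\mathsf d_A\le R_{f,f}(\mathsf d_X)$ for $f:A\to X$, $(R_{f,g}(\alpha))^\bot\le R_{g,f}(\alpha^\bot)$. The graph of $f:X\to Y$ is $\Gamma_f=R_{f,\mathrm{id}_Y}(\mathsf d_Y)\in R(X,Y)$. $R$ is extensional if $\Gamma_f=\Gamma_g$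 implies $f=g$ for all parallel $f,g$. Quotients. An $R$-equivalence relation on $X$ is $\rho\in R(X,X)$ with $\mathsf d_X\le\rho$, $\rho^\bot\le\rho$, $\rho;\rho\le\rho$. A quotient arrow of $\rho$ is $q:X\to W$ with $\rho\le\Gamma_q;\Gamma_q^\bot$ such that for every $f:X\to Z$ with $\rho\le\Gamma_f;\Gamma_f^\bot$ there is a unique $h:W\to Z$ with $f=h\circ q$; it is effective if $\rho=\Gamma_q;\Gamma_q^\bot$ and descent if $\Gamma_q^\bot;\Gamma_q=\mathsf d_W$. $R$ has quotients if every $R$-equivalence relation has an effective descent quotient arrow. "Quotient arrow" without further specification means quotient arrow of some $R$-equivalence relation. If $R$ has quotients, an object $P$ is $R$-projective if for every $f:P\to Y$ and every quotient arrow $q:X\to Y$ there is $h:P\to X$ with $f=q\circ h$. An $R$-projective cover is a full subcategory of the base all of whose objects are $R$-projective and such that every object $X$ of the base admits a quotient arrow $P\to X$ with $P$ in that subcategory. 1-arrows and 2-arrows. A 1-arrow $F:R\to S$ of relational doctrines (bases $\mathcal C,\mathcal D$) is a pair $\langle\widehat F,\overline F\rangle$ of a functor $\widehat F:\mathcal C\to\mathcal D$ and a natural family of monotone maps $\overline F_{X,Y}:R(X,Y)\to S(\widehat FX,\widehat FY)$ preserving $\mathsf d$, $;$ and $(-)^\bot$. A 2-arrow $\theta:F\Rightarrow G$ is a natural transformation $\theta:\widehat F\to\widehat G$ with $\overline F_{X,Y}(\alpha)\le S_{\theta_X,\theta_Y}(\overline G_{X,Y}(\alpha))$ for all $\alpha$.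 $F$ preserves quotients if whenever $q$ is a quotient arrow of an $R$-equivalence relation $\rho$ on $X$, $\widehat Fq$ is a quotient arrow of $\overline F_{X,X}(\rho)$. $\mathbf{RD}$ is the resulting 2-category of relational doctrines; $\mathbf{EQRD}$ is the 2-category of extensional relational doctrines with quotients, quotient-preserving 1-arrows and all 2-arrows between them. Monads. A monad $\mathbb T=\langle T,\eta,\mu\rangle$ on $R$ in $\mathbf{RD}$ is a 1-arrow $T=\langle\widehat T,\overline T\rangle:R\to R$ with 2-arrows $\eta:\mathrm{Id}\Rightarrow T$, $\mu:T\circ T\Rightarrow T$ such that $\widehat{\mathbb T}=\langle\widehat T,\eta,\mu\rangle$ is a monad on the category $\mathcal C$; it is a monad in $\mathbf{EQRD}$ if moreover $R$ is in $\mathbf{EQRD}$ and $T$ preserves quotients. The Eilenberg–Moore doctrine $R^{\mathbb T}$ has as base the Eilenberg–Moore category $\mathcal C^{\widehat{\mathbb T}}$, with fibres $R^{\mathbb T}(\langle X,a\rangle,\langle Y,b\rangle)=\{\alpha\in R(X,Y)\mid\Gamma_a^\bot;\overline T_{X,Y}(\alpha);\Gamma_b\le\alpha\}$, with reindexing $R^{\mathbb T}_{f,g}=R_{f,g}$ and the relational operations of $R$. If $\mathbb T$ is in $\mathbf{EQRD}$, then $R^{\mathbb T}$ is extensional and has quotients. For a full subcategory $\mathcal D$ of $\mathcal C$, $\mathcal D_{\widehat{\mathbb T}}$ is the full subcategory of $\mathcal C^{\widehat{\mathbb T}}$ on the free algebras $\langle\widehat TX,\mu_X\rangle$ with $X$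 in $\mathcal D$. *)

theory Defs
  imports Main
begin

text \<open>
  Arrows carry their domain and codomain, so hom-sets are disjoint. All operations are total HOL
  functions that are only constrained on the objects, arrows and fibres of the structure at hand.
\<close>

record ('o, 'm) cat =
  Ob :: "'o set"
  Ar :: "'m set"
  Dom :: "'m \<Rightarrow> 'o"
  Cod :: "'m \<Rightarrow> 'o"
  Ide :: "'o \<Rightarrow> 'm"
  Comp :: "'m \<Rightarrow> 'm \<Rightarrow> 'm" (infixr "\<bullet>\<index>" 75)

definition hom :: "('o, 'm) cat \<Rightarrow> 'o \<Rightarrow> 'o \<Rightarrow> 'm set" where
  "hom C X Y = {f \<in> Ar C. Dom C f = X \<and> Cod C f = Y}"

locale category =
  fixes C :: "('o, 'm) cat" (structure)
  assumes Dom_Ob: "f \<in> Ar C \<Longrightarrow> Dom C f \<in> Ob C"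
    and Cod_Ob: "f \<in> Ar C \<Longrightarrow> Cod C f \<in> Ob C"
    and Ide_hom: "X \<in> Ob C \<Longrightarrow> Ide C X \<in> hom C X X"
    and Comp_hom: "f \<in> hom C X Y \<Longrightarrow> g \<in> hom C Y Z \<Longrightarrow> g \<bullet> f \<in> hom C X Z"
    and Comp_Ide: "f \<in> hom C X Y \<Longrightarrow> f \<bullet> Ide C X = f"
    and Ide_Comp: "f \<in> hom C X Y \<Longrightarrow> Ide C Y \<bullet> f = f"
    and Comp_assoc: "f \<in> hom C X Y \<Longrightarrow> g \<in> hom C Y Z \<Longrightarrow> h \<in> hom C Z W \<Longrightarrow>
      h \<bullet> (g \<bullet> f) = (h \<bullet> g) \<bullet> f"

text \<open>
  Fibres need not be disjoint, so the operations on them are indexed by objects: for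
  \<open>\<alpha> \<in> Fib R X Y\<close> and \<open>\<beta> \<in> Fib R Y Z\<close>, \<open>RComp R X Y Z \<alpha> \<beta>\<close> is the composite
  \<open>\<alpha> ; \<beta>\<close> in diagrammatic order, \<open>RConv R X Y \<alpha> \<in> Fib R Y X\<close> is the converse of
  \<open>\<alpha>\<close>, and \<open>RIde R X \<in> Fib R X X\<close> is the identity relation. For arrows \<open>f : A \<rightarrow> X\<close> and
  \<open>g : B \<rightarrow> Y\<close>, \<open>Reidx R f g\<close> maps \<open>Fib R X Y\<close> to \<open>Fib R A B\<close>.
\<close>

record ('o, 'm, 'r) doctrine =
  Base :: "('o, 'm) cat"
  Fib :: "'o \<Rightarrow> 'o \<Rightarrow> 'r set"
  Leq :: "'o \<Rightarrow> 'o \<Rightarrow> 'r \<Rightarrow> 'r \<Rightarrow> bool"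
  Reidx :: "'m \<Rightarrow> 'm \<Rightarrow> 'r \<Rightarrow> 'r"
  RComp :: "'o \<Rightarrow> 'o \<Rightarrow> 'o \<Rightarrow> 'r \<Rightarrow> 'r \<Rightarrow> 'r"
  RIde :: "'o \<Rightarrow> 'r"
  RConv :: "'o \<Rightarrow> 'o \<Rightarrow> 'r \<Rightarrow> 'r"

locale relational_doctrine =
  fixes R :: "('o, 'm, 'r) doctrine"
  assumes base_category: "category (Base R)"
    and Leq_refl: "\<lbrakk>X \<in> Ob (Base R); Y \<in> Ob (Base R); \<alpha> \<in> Fib R X Y\<rbrakk> \<Longrightarrow> Leq R X Y \<alpha> \<alpha>"
    and Leq_trans: "\<lbrakk>X \<in> Ob (Base R); Y \<in> Ob (Base R);
      \<alpha> \<in> Fib R X Y; \<beta> \<in> Fib R X Y; \<gamma> \<in> Fib R X Y; Leq R X Y \<alpha> \<beta>; Leq R X Y \<beta> \<gamma>\<rbrakk>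
      \<Longrightarrow> Leq R X Y \<alpha> \<gamma>"
    and Leq_antisym: "\<lbrakk>X \<in> Ob (Base R); Y \<in> Ob (Base R);
      \<alpha> \<in> Fib R X Y; \<beta> \<in> Fib R X Y; Leq R X Y \<alpha> \<beta>; Leq R X Y \<beta> \<alpha>\<rbrakk> \<Longrightarrow> \<alpha> = \<beta>"
    and Reidx_Fib: "\<lbrakk>f \<in> hom (Base R) A X; g \<in> hom (Base R) B Y; \<alpha> \<in> Fib R X Y\<rbrakk>
      \<Longrightarrow> Reidx R f g \<alpha> \<in> Fib R A B"
    and Reidx_mono: "\<lbrakk>f \<in> hom (Base R) A X; g \<in> hom (Base R) B Y;
      \<alpha> \<in> Fib R X Y; \<beta> \<in> Fib R X Y; Leq R X Y \<alpha> \<beta>\<rbrakk>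
      \<Longrightarrow> Leq R A B (Reidx R f g \<alpha>) (Reidx R f g \<beta>)"
    and Reidx_Ide: "\<lbrakk>X \<in> Ob (Base R); Y \<in> Ob (Base R); \<alpha> \<in> Fib R X Y\<rbrakk>
      \<Longrightarrow> Reidx R (Ide (Base R) X) (Ide (Base R) Y) \<alpha> = \<alpha>"
    and Reidx_Comp: "\<lbrakk>f' \<in> hom (Base R) A' A; f \<in> hom (Base R) A X;
      g' \<in> hom (Base R) B' B; g \<in> hom (Base R) B Y; \<alpha> \<in> Fib R X Y\<rbrakk>
      \<Longrightarrow> Reidx R (f \<bullet>\<^bsub>Base R\<^esub> f') (g \<bullet>\<^bsub>Base R\<^esub> g') \<alpha> = Reidx R f' g' (Reidx R f g \<alpha>)"
    and RComp_Fib: "\<lbrakk>X \<in> Ob (Base R); Y \<in> Ob (Base R); Z \<in> Ob (Base R);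
      \<alpha> \<in> Fib R X Y; \<beta> \<in> Fib R Y Z\<rbrakk> \<Longrightarrow> RComp R X Y Z \<alpha> \<beta> \<in> Fib R X Z"
    and RComp_mono: "\<lbrakk>X \<in> Ob (Base R); Y \<in> Ob (Base R); Z \<in> Ob (Base R);
      \<alpha> \<in> Fib R X Y; \<alpha>' \<in> Fib R X Y; \<beta> \<in> Fib R Y Z; \<beta>' \<in> Fib R Y Z;
      Leq R X Y \<alpha> \<alpha>'; Leq R Y Z \<beta> \<beta>'\<rbrakk>
      \<Longrightarrow> Leq R X Z (RComp R X Y Z \<alpha> \<beta>) (RComp R X Y Z \<alpha>' \<beta>')"
    and RIde_Fib: "X \<in> Ob (Base R) \<Longrightarrow> RIde R X \<in> Fib R X X"
    and RConv_Fib: "\<lbrakk>X \<in> Ob (Base R); Y \<in> Ob (Base R); \<alpha> \<in> Fib R X Y\<rbrakk>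
      \<Longrightarrow> RConv R X Y \<alpha> \<in> Fib R Y X"
    and RConv_mono: "\<lbrakk>X \<in> Ob (Base R); Y \<in> Ob (Base R);
      \<alpha> \<in> Fib R X Y; \<beta> \<in> Fib R X Y; Leq R X Y \<alpha> \<beta>\<rbrakk>
      \<Longrightarrow> Leq R Y X (RConv R X Y \<alpha>) (RConv R X Y \<beta>)"
    and RComp_assoc: "\<lbrakk>X \<in> Ob (Base R); Y \<in> Ob (Base R); Z \<in> Ob (Base R); W \<in> Ob (Base R);
      \<alpha> \<in> Fib R X Y; \<beta> \<in> Fib R Y Z; \<gamma> \<in> Fib R Z W\<rbrakk>
      \<Longrightarrow> RComp R X Y W \<alpha> (RComp R Y Z W \<beta> \<gamma>) = RComp R X Z W (RComp R X Y Z \<alpha> \<beta>) \<gamma>"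
    and RIde_RComp: "\<lbrakk>X \<in> Ob (Base R); Y \<in> Ob (Base R); \<alpha> \<in> Fib R X Y\<rbrakk>
      \<Longrightarrow> RComp R X X Y (RIde R X) \<alpha> = \<alpha>"
    and RComp_RIde: "\<lbrakk>X \<in> Ob (Base R); Y \<in> Ob (Base R); \<alpha> \<in> Fib R X Y\<rbrakk>
      \<Longrightarrow> RComp R X Y Y \<alpha> (RIde R Y) = \<alpha>"
    and RConv_RComp: "\<lbrakk>X \<in> Ob (Base R); Y \<in> Ob (Base R); Z \<in> Ob (Base R);
      \<alpha> \<in> Fib R X Y; \<beta> \<in> Fib R Y Z\<rbrakk>
      \<Longrightarrow> RConv R X Z (RComp R X Y Z \<alpha> \<beta>) = RComp R Z Y X (RConv R Y Z \<beta>) (RConv R X Y \<alpha>)"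
    and RConv_RIde: "X \<in> Ob (Base R) \<Longrightarrow> RConv R X X (RIde R X) = RIde R X"
    and RConv_RConv: "\<lbrakk>X \<in> Ob (Base R); Y \<in> Ob (Base R); \<alpha> \<in> Fib R X Y\<rbrakk>
      \<Longrightarrow> RConv R Y X (RConv R X Y \<alpha>) = \<alpha>"
    and Reidx_RComp: "\<lbrakk>f \<in> hom (Base R) A X; g \<in> hom (Base R) B Y; h \<in> hom (Base R) D Z;
      \<alpha> \<in> Fib R X Y; \<beta> \<in> Fib R Y Z\<rbrakk>
      \<Longrightarrow> Leq R A D (RComp R A B D (Reidx R f g \<alpha>) (Reidx R g h \<beta>))
                     (Reidx R f h (RComp R X Y Z \<alpha> \<beta>))"
    and Reidx_RIde: "f \<in> hom (Base R) A X \<Longrightarrow> Leq R A A (RIde R A) (Reidx R f f (RIde R X))"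
    and Reidx_RConv: "\<lbrakk>f \<in> hom (Base R) A X; g \<in> hom (Base R) B Y; \<alpha> \<in> Fib R X Y\<rbrakk>
      \<Longrightarrow> Leq R B A (RConv R A B (Reidx R f g \<alpha>)) (Reidx R g f (RConv R X Y \<alpha>))"

definition graph :: "('o, 'm, 'r) doctrine \<Rightarrow> 'm \<Rightarrow> 'r" where
  "graph R f = (let Y = Cod (Base R) f in Reidx R f (Ide (Base R) Y) (RIde R Y))"

definition cograph :: "('o, 'm, 'r) doctrine \<Rightarrow> 'm \<Rightarrow> 'r" where
  "cograph R f = RConv R (Dom (Base R) f) (Cod (Base R) f) (graph R f)"

definition extensional :: "('o, 'm, 'r) doctrine \<Rightarrow> bool" where
  "extensional R \<longleftrightarrow>
    (\<forall>X\<in>Ob (Base R). \<forall>Y\<in>Ob (Base R). \<forall>f\<in>hom (Base R) X Y. \<forall>g\<in>hom (Base R) X Y.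
      graph R f = graph R g \<longrightarrow> f = g)"

definition equivalence_relation :: "('o, 'm, 'r) doctrine \<Rightarrow> 'o \<Rightarrow> 'r \<Rightarrow> bool" where
  "equivalence_relation R X \<rho> \<longleftrightarrow>
    X \<in> Ob (Base R) \<and> \<rho> \<in> Fib R X X \<and>
    Leq R X X (RIde R X) \<rho> \<and>
    Leq R X X (RConv R X X \<rho>) \<rho> \<and>
    Leq R X X (RComp R X X X \<rho> \<rho>) \<rho>"

definition graph_kernel :: "('o, 'm, 'r) doctrine \<Rightarrow> 'o \<Rightarrow> 'o \<Rightarrow> 'm \<Rightarrow> 'r" where
  "graph_kernel R X Y f = RComp R X Y X (graph R f) (cograph R f)"

definition quotient_arrow_of :: "('o, 'm, 'r) doctrine \<Rightarrow> 'o \<Rightarrow> 'r \<Rightarrow> 'o \<Rightarrow> 'm \<Rightarrow> bool" where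
  "quotient_arrow_of R X \<rho> W q \<longleftrightarrow>
    q \<in> hom (Base R) X W \<and>
    Leq R X X \<rho> (graph_kernel R X W q) \<and>
    (\<forall>Z\<in>Ob (Base R). \<forall>f\<in>hom (Base R) X Z. Leq R X X \<rho> (graph_kernel R X Z f) \<longrightarrow>
      (\<exists>!h. h \<in> hom (Base R) W Z \<and> f = h \<bullet>\<^bsub>Base R\<^esub> q))"

definition effective :: "('o, 'm, 'r) doctrine \<Rightarrow> 'o \<Rightarrow> 'r \<Rightarrow> 'o \<Rightarrow> 'm \<Rightarrow> bool" where
  "effective R X \<rho> W q \<longleftrightarrow> \<rho> = graph_kernel R X W q"

definition descent :: "('o, 'm, 'r) doctrine \<Rightarrow> 'o \<Rightarrow> 'o \<Rightarrow> 'm \<Rightarrow> bool" where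
  "descent R X W q \<longleftrightarrow> RComp R W X W (cograph R q) (graph R q) = RIde R W"

definition has_quotients :: "('o, 'm, 'r) doctrine \<Rightarrow> bool" where
  "has_quotients R \<longleftrightarrow>
    (\<forall>X \<rho>. equivalence_relation R X \<rho> \<longrightarrow>
      (\<exists>W q. quotient_arrow_of R X \<rho> W q \<and> effective R X \<rho> W q \<and> descent R X W q))"

definition quotient_arrow :: "('o, 'm, 'r) doctrine \<Rightarrow> 'o \<Rightarrow> 'o \<Rightarrow> 'm \<Rightarrow> bool" where
  "quotient_arrow R X W q \<longleftrightarrow> (\<exists>\<rho>. equivalence_relation R X \<rho> \<and> quotient_arrow_of R X \<rho> W q)"

definition projective :: "('o, 'm, 'r) doctrine \<Rightarrow> 'o \<Rightarrow> bool" where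
  "projective R P \<longleftrightarrow>
    P \<in> Ob (Base R) \<and>
    (\<forall>X Y f q. f \<in> hom (Base R) P Y \<longrightarrow> quotient_arrow R X Y q \<longrightarrow>
      (\<exists>h\<in>hom (Base R) P X. f = q \<bullet>\<^bsub>Base R\<^esub> h))"

text \<open>A full subcategory is given by its set of objects.\<close>

definition projective_cover :: "('o, 'm, 'r) doctrine \<Rightarrow> 'o set \<Rightarrow> bool" where
  "projective_cover R \<G> \<longleftrightarrow>
    \<G> \<subseteq> Ob (Base R) \<and>
    (\<forall>P\<in>\<G>. projective R P) \<and>
    (\<forall>X\<in>Ob (Base R). \<exists>P\<in>\<G>. \<exists>q. quotient_arrow R P X q)"

record ('o, 'm, 'r, 'p, 'n, 's) arrow1 =
  FOb :: "'o \<Rightarrow> 'p"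
  FAr :: "'m \<Rightarrow> 'n"
  FRel :: "'o \<Rightarrow> 'o \<Rightarrow> 'r \<Rightarrow> 's"

definition is_functor :: "('o, 'm) cat \<Rightarrow> ('p, 'n) cat \<Rightarrow> ('o \<Rightarrow> 'p) \<Rightarrow> ('m \<Rightarrow> 'n) \<Rightarrow> bool" where
  "is_functor C D F\<^sub>0 F\<^sub>1 \<longleftrightarrow>
    (\<forall>X\<in>Ob C. F\<^sub>0 X \<in> Ob D) \<and>
    (\<forall>X Y. \<forall>f\<in>hom C X Y. F\<^sub>1 f \<in> hom D (F\<^sub>0 X) (F\<^sub>0 Y)) \<and>
    (\<forall>X\<in>Ob C. F\<^sub>1 (Ide C X) = Ide D (F\<^sub>0 X)) \<and>
    (\<forall>X Y Z. \<forall>f\<in>hom C X Y. \<forall>g\<in>hom C Y Z. F\<^sub>1 (g \<bullet>\<^bsub>C\<^esub> f) = F\<^sub>1 g \<bullet>\<^bsub>D\<^esub> F\<^sub>1 f)"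

locale one_arrow =
  dom: relational_doctrine R + cod: relational_doctrine S
  for R :: "('o, 'm, 'r) doctrine" and S :: "('p, 'n, 's) doctrine" +
  fixes F :: "('o, 'm, 'r, 'p, 'n, 's) arrow1"
  assumes base_functor: "is_functor (Base R) (Base S) (FOb F) (FAr F)"
    and FRel_Fib: "\<lbrakk>X \<in> Ob (Base R); Y \<in> Ob (Base R); \<alpha> \<in> Fib R X Y\<rbrakk>
      \<Longrightarrow> FRel F X Y \<alpha> \<in> Fib S (FOb F X) (FOb F Y)"
    and FRel_mono: "\<lbrakk>X \<in> Ob (Base R); Y \<in> Ob (Base R);
      \<alpha> \<in> Fib R X Y; \<beta> \<in> Fib R X Y; Leq R X Y \<alpha> \<beta>\<rbrakk>
      \<Longrightarrow> Leq S (FOb F X) (FOb F Y) (FRel F X Y \<alpha>) (FRel F X Y \<beta>)"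
    and FRel_natural: "\<lbrakk>f \<in> hom (Base R) A X; g \<in> hom (Base R) B Y; \<alpha> \<in> Fib R X Y\<rbrakk>
      \<Longrightarrow> FRel F A B (Reidx R f g \<alpha>) = Reidx S (FAr F f) (FAr F g) (FRel F X Y \<alpha>)"
    and FRel_RIde: "X \<in> Ob (Base R) \<Longrightarrow> FRel F X X (RIde R X) = RIde S (FOb F X)"
    and FRel_RComp: "\<lbrakk>X \<in> Ob (Base R); Y \<in> Ob (Base R); Z \<in> Ob (Base R);
      \<alpha> \<in> Fib R X Y; \<beta> \<in> Fib R Y Z\<rbrakk>
      \<Longrightarrow> FRel F X Z (RComp R X Y Z \<alpha> \<beta>) =
          RComp S (FOb F X) (FOb F Y) (FOb F Z) (FRel F X Y \<alpha>) (FRel F Y Z \<beta>)"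
    and FRel_RConv: "\<lbrakk>X \<in> Ob (Base R); Y \<in> Ob (Base R); \<alpha> \<in> Fib R X Y\<rbrakk>
      \<Longrightarrow> FRel F Y X (RConv R X Y \<alpha>) = RConv S (FOb F X) (FOb F Y) (FRel F X Y \<alpha>)"

definition arrow1_id :: "('o, 'm, 'r, 'o, 'm, 'r) arrow1" where
  "arrow1_id = \<lparr>FOb = \<lambda>X. X, FAr = \<lambda>f. f, FRel = \<lambda>X Y \<alpha>. \<alpha>\<rparr>"

definition arrow1_comp ::
  "('p, 'n, 's, 'q, 'k, 't) arrow1 \<Rightarrow> ('o, 'm, 'r, 'p, 'n, 's) arrow1 \<Rightarrow>
   ('o, 'm, 'r, 'q, 'k, 't) arrow1" where
  "arrow1_comp G F =
    \<lparr>FOb = \<lambda>X. FOb G (FOb F X),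
     FAr = \<lambda>f. FAr G (FAr F f),
     FRel = \<lambda>X Y \<alpha>. FRel G (FOb F X) (FOb F Y) (FRel F X Y \<alpha>)\<rparr>"

locale two_arrow =
  source: one_arrow R S F + target: one_arrow R S G
  for R :: "('o, 'm, 'r) doctrine" and S :: "('p, 'n, 's) doctrine"
    and F G :: "('o, 'm, 'r, 'p, 'n, 's) arrow1" +
  fixes \<theta> :: "'o \<Rightarrow> 'n"
  assumes component: "X \<in> Ob (Base R) \<Longrightarrow> \<theta> X \<in> hom (Base S) (FOb F X) (FOb G X)"
    and natural: "f \<in> hom (Base R) X Y \<Longrightarrow>
      FAr G f \<bullet>\<^bsub>Base S\<^esub> \<theta> X = \<theta> Y \<bullet>\<^bsub>Base S\<^esub> FAr F f"
    and lax: "\<lbrakk>X \<in> Ob (Base R); Y \<in> Ob (Base R); \<alpha> \<in> Fib R X Y\<rbrakk>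
      \<Longrightarrow> Leq S (FOb F X) (FOb F Y) (FRel F X Y \<alpha>) (Reidx S (\<theta> X) (\<theta> Y) (FRel G X Y \<alpha>))"

definition preserves_quotients ::
  "('o, 'm, 'r) doctrine \<Rightarrow> ('p, 'n, 's) doctrine \<Rightarrow> ('o, 'm, 'r, 'p, 'n, 's) arrow1 \<Rightarrow> bool" where
  "preserves_quotients R S F \<longleftrightarrow>
    (\<forall>X \<rho> W q. equivalence_relation R X \<rho> \<longrightarrow> quotient_arrow_of R X \<rho> W q \<longrightarrow>
      quotient_arrow_of S (FOb F X) (FRel F X X \<rho>) (FOb F W) (FAr F q))"

record ('o, 'm, 'r) monad_data =
  MFun :: "('o, 'm, 'r, 'o, 'm, 'r) arrow1"
  Unit :: "'o \<Rightarrow> 'm"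
  Mult :: "'o \<Rightarrow> 'm"

locale rd_monad =
  unit: two_arrow R R arrow1_id "MFun T" "Unit T" +
  mult: two_arrow R R "arrow1_comp (MFun T) (MFun T)" "MFun T" "Mult T"
  for R :: "('o, 'm, 'r) doctrine" and T :: "('o, 'm, 'r) monad_data" +
  assumes left_unit: "X \<in> Ob (Base R) \<Longrightarrow>
      Mult T X \<bullet>\<^bsub>Base R\<^esub> Unit T (FOb (MFun T) X) = Ide (Base R) (FOb (MFun T) X)"
    and right_unit: "X \<in> Ob (Base R) \<Longrightarrow>
      Mult T X \<bullet>\<^bsub>Base R\<^esub> FAr (MFun T) (Unit T X) = Ide (Base R) (FOb (MFun T) X)"
    and mult_assoc: "X \<in> Ob (Base R) \<Longrightarrow>
      Mult T X \<bullet>\<^bsub>Base R\<^esub> Mult T (FOb (MFun T) X) =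
      Mult T X \<bullet>\<^bsub>Base R\<^esub> FAr (MFun T) (Mult T X)"

definition eqrd_object :: "('o, 'm, 'r) doctrine \<Rightarrow> bool" where
  "eqrd_object R \<longleftrightarrow> relational_doctrine R \<and> extensional R \<and> has_quotients R"

definition eqrd_monad :: "('o, 'm, 'r) doctrine \<Rightarrow> ('o, 'm, 'r) monad_data \<Rightarrow> bool" where
  "eqrd_monad R T \<longleftrightarrow> rd_monad R T \<and> eqrd_object R \<and> preserves_quotients R R (MFun T)"

definition em_algebras :: "('o, 'm) cat \<Rightarrow> ('o, 'm, 'r) monad_data \<Rightarrow> ('o \<times> 'm) set" where
  "em_algebras C T =
    {(X, a). X \<in> Ob C \<and> a \<in> hom C (FOb (MFun T) X) X \<and>
      a \<bullet>\<^bsub>C\<^esub> Unit T X = Ide C X \<and>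
      a \<bullet>\<^bsub>C\<^esub> Mult T X = a \<bullet>\<^bsub>C\<^esub> FAr (MFun T) a}"

text \<open>
  An algebra homomorphism is recorded with its source and target algebra, since the underlying
  arrow does not determine them.
\<close>

definition em_category ::
  "('o, 'm) cat \<Rightarrow> ('o, 'm, 'r) monad_data \<Rightarrow>
   ('o \<times> 'm, ('o \<times> 'm) \<times> 'm \<times> ('o \<times> 'm)) cat" where
  "em_category C T =
    \<lparr>Ob = em_algebras C T,
     Ar = {((X, a), f, (Y, b)) | X a f Y b.
            (X, a) \<in> em_algebras C T \<and> (Y, b) \<in> em_algebras C T \<and> f \<in> hom C X Y \<and>
            f \<bullet>\<^bsub>C\<^esub> a = b \<bullet>\<^bsub>C\<^esub> FAr (MFun T) f},
     Dom = \<lambda>(A, f, B). A,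
     Cod = \<lambda>(A, f, B). B,
     Ide = \<lambda>(X, a). ((X, a), Ide C X, (X, a)),
     Comp = \<lambda>(B', g, D) (A, f, B). (A, g \<bullet>\<^bsub>C\<^esub> f, D)\<rparr>"

definition em_fibre ::
  "('o, 'm, 'r) doctrine \<Rightarrow> ('o, 'm, 'r) monad_data \<Rightarrow> 'o \<times> 'm \<Rightarrow> 'o \<times> 'm \<Rightarrow> 'r set" where
  "em_fibre R T = (\<lambda>(X, a) (Y, b).
    {\<alpha> \<in> Fib R X Y.
      Leq R X Y
        (RComp R X (FOb (MFun T) Y) Y
          (RComp R X (FOb (MFun T) X) (FOb (MFun T) Y) (cograph R a) (FRel (MFun T) X Y \<alpha>))
          (graph R b))
        \<alpha>})"

definition em_doctrine ::
  "('o, 'm, 'r) doctrine \<Rightarrow> ('o, 'm, 'r) monad_data \<Rightarrow>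
   ('o \<times> 'm, ('o \<times> 'm) \<times> 'm \<times> ('o \<times> 'm), 'r) doctrine" where
  "em_doctrine R T =
    \<lparr>Base = em_category (Base R) T,
     Fib = em_fibre R T,
     Leq = \<lambda>(X, a) (Y, b). Leq R X Y,
     Reidx = \<lambda>(A, f, B) (A', g, B'). Reidx R f g,
     RComp = \<lambda>(X, a) (Y, b) (Z, c). RComp R X Y Z,
     RIde = \<lambda>(X, a). RIde R X,
     RConv = \<lambda>(X, a) (Y, b). RConv R X Y\<rparr>"

definition free_algebras :: "('o, 'm, 'r) monad_data \<Rightarrow> 'o set \<Rightarrow> ('o \<times> 'm) set" where
  "free_algebras T \<D> = {(FOb (MFun T) X, Mult T X) | X. X \<in> \<D>}"

end

theory Submission
  imports Defs
begin

text \<open>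
  The graph kernel of \<open>f : X \<rightarrow> Y\<close> is the reindexing of the identity relation along \<open>(f, f)\<close>, and
  membership in a fibre of \<open>R\<^sup>T\<close> amounts to \<open>T \<alpha> \<le> R\<^sub>a\<^sub>,\<^sub>b(\<alpha>)\<close>. Hence, since \<open>T\<close> preserves
  quotients, the quotient of an \<open>R\<^sup>T\<close>-equivalence relation is computed in \<open>R\<close>, and a homomorphism of
  algebras is a quotient arrow of \<open>R\<^sup>T\<close> iff its underlying arrow is one of \<open>R\<close>. So lifts out of a
  free algebra on a projective \<open>P\<close> extend lifts out of \<open>P\<close>. An algebra \<open>(X, a)\<close> covered
  by \<open>p : P \<rightarrow> X\<close> is covered by \<open>a \<cdot> T p\<close>, where \<open>a\<close> is a quotient arrow because \<open>R\<close> is extensional and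
  \<open>a\<close> is split by the unit. The converse is the case of the identity monad.
\<close>

context category
begin

lemma hom_Ob: "f \<in> hom C X Y \<Longrightarrow> X \<in> Ob C" "f \<in> hom C X Y \<Longrightarrow> Y \<in> Ob C"
  using Dom_Ob Cod_Ob by (auto simp: hom_def)

end

lemma hom_Dom_Cod: "f \<in> hom C X Y \<Longrightarrow> Dom C f = X" "f \<in> hom C X Y \<Longrightarrow> Cod C f = Y"
  by (auto simp: hom_def)

section \<open>Reindexing, graphs and quotient arrows\<close>

definition inverse_arrows :: "('o, 'm) cat \<Rightarrow> 'o \<Rightarrow> 'o \<Rightarrow> 'm \<Rightarrow> 'm \<Rightarrow> bool" where
  "inverse_arrows C X Y i j \<longleftrightarrow>
    i \<in> hom C X Y \<and> j \<in> hom C Y X \<and> j \<bullet>\<^bsub>C\<^esub> i = Ide C X \<and> i \<bullet>\<^bsub>C\<^esub> j = Ide C Y"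

lemma quotient_arrow_ofD:
  assumes "quotient_arrow_of R X \<rho> W q"
  shows "q \<in> hom (Base R) X W" "Leq R X X \<rho> (graph_kernel R X W q)"
  using assms by (auto simp: quotient_arrow_of_def)

lemma quotient_arrow_of_factor:
  assumes "quotient_arrow_of R X \<rho> W q" "Z \<in> Ob (Base R)" "f \<in> hom (Base R) X Z"
    "Leq R X X \<rho> (graph_kernel R X Z f)"
  obtains h where "h \<in> hom (Base R) W Z" "f = h \<bullet>\<^bsub>Base R\<^esub> q"
    "\<And>h'. h' \<in> hom (Base R) W Z \<Longrightarrow> f = h' \<bullet>\<^bsub>Base R\<^esub> q \<Longrightarrow> h' = h"
proof -
  have "\<exists>!h. h \<in> hom (Base R) W Z \<and> f = h \<bullet>\<^bsub>Base R\<^esub> q"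
    using assms by (auto simp: quotient_arrow_of_def)
  then show thesis using that by blast
qed

text \<open>The usual comparison of two universal arrows. Only \<open>category (Base R)\<close> is
  assumed, because the lemma is also applied to \<open>em_doctrine R T\<close>, for which just the
  base category is verified.\<close>

lemma quotient_arrow_of_unique:
  assumes cat: "category (Base R)"
    and q: "quotient_arrow_of R X \<rho> W q" and q': "quotient_arrow_of R X \<rho> W' q'"
  obtains i j where "inverse_arrows (Base R) W W' i j" "q' = i \<bullet>\<^bsub>Base R\<^esub> q"
proof -
  interpret category "Base R" by (rule cat)
  note qD = quotient_arrow_ofD[OF q] and q'D = quotient_arrow_ofD[OF q']
  note W = hom_Ob(2)[OF qD(1)] and W' = hom_Ob(2)[OF q'D(1)]
  obtain i where i: "i \<in> hom (Base R) W W'" "q' = i \<bullet>\<^bsub>Base R\<^esub> q"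
    using quotient_arrow_of_factor[OF q W' q'D] by metis
  obtain j where j: "j \<in> hom (Base R) W' W" "q = j \<bullet>\<^bsub>Base R\<^esub> q'"
    using quotient_arrow_of_factor[OF q' W qD] by metis
  have "q = (j \<bullet>\<^bsub>Base R\<^esub> i) \<bullet>\<^bsub>Base R\<^esub> q"
    using i j Comp_assoc[OF qD(1) i(1) j(1)] by simp
  moreover have "q = Ide (Base R) W \<bullet>\<^bsub>Base R\<^esub> q" using Ide_Comp qD(1) by simp
  ultimately have ji: "j \<bullet>\<^bsub>Base R\<^esub> i = Ide (Base R) W"
    using quotient_arrow_of_factor[OF q W qD] Comp_hom[OF i(1) j(1)] Ide_hom[OF W] by metis
  have "q' = (i \<bullet>\<^bsub>Base R\<^esub> j) \<bullet>\<^bsub>Base R\<^esub> q'"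
    using i j Comp_assoc[OF q'D(1) j(1) i(1)] by simp
  moreover have "q' = Ide (Base R) W' \<bullet>\<^bsub>Base R\<^esub> q'" using Ide_Comp q'D(1) by simp
  ultimately have ij: "i \<bullet>\<^bsub>Base R\<^esub> j = Ide (Base R) W'"
    using quotient_arrow_of_factor[OF q' W' q'D] Comp_hom[OF j(1) i(1)] Ide_hom[OF W'] by metis
  show thesis
    using that[of i j] i j(1) ji ij by (simp add: inverse_arrows_def)
qed

context relational_doctrine
begin

sublocale base: category "Base R"
  by (rule base_category)

abbreviation comp (infixr "\<cdot>" 75) where "g \<cdot> f \<equiv> g \<bullet>\<^bsub>Base R\<^esub> f"

lemmas base_facts = base.hom_Ob base.Ide_hom Reidx_Fib RComp_Fib RIde_Fib RConv_Fib

lemma quotient_arrow_of_epi: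
  assumes q: "quotient_arrow_of R X \<rho> W q" and \<rho>: "\<rho> \<in> Fib R X X"
    and g: "g \<in> hom (Base R) W Z" and h: "h \<in> hom (Base R) W Z" and eq: "g \<cdot> q = h \<cdot> q"
    and le: "Leq R X X \<rho> (graph_kernel R X Z (g \<cdot> q))"
  shows "g = h"
proof -
  note qD = quotient_arrow_ofD[OF q]
  show ?thesis
    using quotient_arrow_of_factor[OF q base.hom_Ob(2)[OF g] base.Comp_hom[OF qD(1) g] le] g h eq
    by metis
qed

text \<open>
  An inequality \<open>\<alpha> \<le> R\<^sub>f\<^sub>,\<^sub>g(\<beta>)\<close> is a cell of a double category; this is horizontal pasting of
  such cells.
\<close>

lemma RComp_Reidx:
  assumes "f \<in> hom (Base R) A X" "g \<in> hom (Base R) B Y" "h \<in> hom (Base R) D Z"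
    and "\<alpha> \<in> Fib R A B" "\<beta> \<in> Fib R B D" "\<alpha>' \<in> Fib R X Y" "\<beta>' \<in> Fib R Y Z"
    and "Leq R A B \<alpha> (Reidx R f g \<alpha>')" "Leq R B D \<beta> (Reidx R g h \<beta>')"
  shows "Leq R A D (RComp R A B D \<alpha> \<beta>) (Reidx R f h (RComp R X Y Z \<alpha>' \<beta>'))"
proof -
  note ob = assms(1-3)[THEN base.hom_Ob(1)] assms(1-3)[THEN base.hom_Ob(2)]
  note fib = Reidx_Fib[OF assms(1,2,6)] Reidx_Fib[OF assms(2,3,7)]
  have "Leq R A D (RComp R A B D \<alpha> \<beta>)
      (RComp R A B D (Reidx R f g \<alpha>') (Reidx R g h \<beta>'))"
    by (rule RComp_mono[OF ob(1-3) assms(4) fib(1) assms(5) fib(2) assms(8,9)])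
  then show ?thesis
    by (rule Leq_trans[OF ob(1,3) RComp_Fib[OF ob(1-3) assms(4,5)] RComp_Fib[OF ob(1-3) fib]
          Reidx_Fib[OF assms(1,3) RComp_Fib[OF ob(4-6) assms(6,7)]] _
          Reidx_RComp[OF assms(1-3,6,7)]])
qed

section \<open>Graphs, cographs and their adjunction with reindexing\<close>

lemma graph_eq: "f \<in> hom (Base R) X Y \<Longrightarrow> graph R f = Reidx R f (Ide (Base R) Y) (RIde R Y)"
  by (simp add: graph_def hom_Dom_Cod)

lemma graph_le: "f \<in> hom (Base R) X Y \<Longrightarrow>
    Leq R X Y (graph R f) (Reidx R f (Ide (Base R) Y) (RIde R Y))"
  by (simp add: graph_eq Leq_refl base.hom_Ob Reidx_Fib[OF _ base.Ide_hom RIde_Fib])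

lemma graph_Fib: "f \<in> hom (Base R) X Y \<Longrightarrow> graph R f \<in> Fib R X Y"
  by (simp add: graph_eq base.hom_Ob Reidx_Fib[OF _ base.Ide_hom RIde_Fib])

text \<open>Applying the lax inequality to the converse of \<open>\<alpha>\<close> and transposing
  by the involution yields the opposite inequality.\<close>

lemma RConv_Reidx:
  assumes "f \<in> hom (Base R) A X" "g \<in> hom (Base R) B Y" "\<alpha> \<in> Fib R X Y"
  shows "RConv R A B (Reidx R f g \<alpha>) = Reidx R g f (RConv R X Y \<alpha>)"
proof -
  have ob: "A \<in> Ob (Base R)" "B \<in> Ob (Base R)" "X \<in> Ob (Base R)" "Y \<in> Ob (Base R)"
    using assms base_facts by meson+
  have fib: "Reidx R f g \<alpha> \<in> Fib R A B" "Reidx R g f (RConv R X Y \<alpha>) \<in> Fib R B A"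
    using assms ob base_facts by meson+
  have "Leq R A B (RConv R B A (Reidx R g f (RConv R X Y \<alpha>))) (Reidx R f g \<alpha>)"
    using Reidx_RConv[OF assms(2,1) RConv_Fib[OF ob(3,4) assms(3)]] RConv_RConv[OF ob(3,4) assms(3)]
    by simp
  then have "Leq R B A (Reidx R g f (RConv R X Y \<alpha>)) (RConv R A B (Reidx R f g \<alpha>))"
    using RConv_mono[OF ob(1,2)] RConv_Fib ob fib RConv_RConv by metis
  then show ?thesis
    using Leq_antisym Reidx_RConv[OF assms] ob fib RConv_Fib by metis
qed

lemma cograph_eq:
  "f \<in> hom (Base R) X Y \<Longrightarrow> cograph R f = Reidx R (Ide (Base R) Y) f (RIde R Y)"
  using RConv_Reidx[of f X Y "Ide (Base R) Y" Y Y "RIde R Y"] base_facts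
  by (simp add: cograph_def hom_Dom_Cod graph_eq RConv_RIde)

lemma cograph_le: "f \<in> hom (Base R) X Y \<Longrightarrow>
    Leq R Y X (cograph R f) (Reidx R (Ide (Base R) Y) f (RIde R Y))"
  by (simp add: cograph_eq Leq_refl base.hom_Ob Reidx_Fib[OF base.Ide_hom _ RIde_Fib])

lemma cograph_Fib: "f \<in> hom (Base R) X Y \<Longrightarrow> cograph R f \<in> Fib R Y X"
  by (simp add: cograph_eq base.hom_Ob Reidx_Fib[OF base.Ide_hom _ RIde_Fib])

text \<open>By functoriality of reindexing both right-hand sides are
  \<open>Reidx R f f (RIde R Y)\<close>. These are the cells that insert a graph or cograph into a
  pasting; \<open>graph_le\<close> and \<open>cograph_le\<close> are the cells that remove
  it.\<close>

lemma RIde_Reidx_graph: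
  assumes "f \<in> hom (Base R) X Y"
  shows "Leq R X X (RIde R X) (Reidx R (Ide (Base R) X) f (graph R f))"
    and "Leq R X X (RIde R X) (Reidx R f (Ide (Base R) X) (cograph R f))"
proof -
  have ob: "X \<in> Ob (Base R)" "Y \<in> Ob (Base R)" using assms base_facts by meson+
  note I = base.Ide_hom[OF ob(1)] base.Ide_hom[OF ob(2)]
  have "Reidx R (Ide (Base R) X) f (graph R f) = Reidx R f f (RIde R Y)"
    using Reidx_Comp[OF I(1) assms assms I(2) RIde_Fib[OF ob(2)]] assms
    by (simp add: graph_eq base.Comp_Ide base.Ide_Comp)
  then show "Leq R X X (RIde R X) (Reidx R (Ide (Base R) X) f (graph R f))"
    using Reidx_RIde[OF assms] by simp
  have "Reidx R f (Ide (Base R) X) (cograph R f) = Reidx R f f (RIde R Y)"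
    using Reidx_Comp[OF assms I(2) I(1) assms RIde_Fib[OF ob(2)]] assms
    by (simp add: cograph_eq base.Comp_Ide base.Ide_Comp)
  then show "Leq R X X (RIde R X) (Reidx R f (Ide (Base R) X) (cograph R f))"
    using Reidx_RIde[OF assms] by simp
qed

text \<open>Three cells are pasted side by side: \<open>graph_le\<close> for \<open>f\<close>, the
  trivial cell on \<open>\<alpha>\<close>, and \<open>cograph_le\<close> for \<open>g\<close>. The
  identity relations in the result then cancel.\<close>

lemma graph_RComp_cograph_le_Reidx:
  assumes f: "f \<in> hom (Base R) A X" and g: "g \<in> hom (Base R) B Y" and \<alpha>: "\<alpha> \<in> Fib R X Y"
  shows "Leq R A B (RComp R A Y B (RComp R A X Y (graph R f) \<alpha>) (cograph R g)) (Reidx R f g \<alpha>)"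
proof -
  have ob: "A \<in> Ob (Base R)" "B \<in> Ob (Base R)" "X \<in> Ob (Base R)" "Y \<in> Ob (Base R)"
    using assms base_facts by meson+
  note I = base.Ide_hom[OF ob(3)] base.Ide_hom[OF ob(4)]
  have "Leq R A Y (RComp R A X Y (graph R f) \<alpha>)
      (Reidx R f (Ide (Base R) Y) (RComp R X X Y (RIde R X) \<alpha>))"
    by (rule RComp_Reidx[OF f I])
      (use assms ob in \<open>simp_all add: graph_Fib RIde_Fib Leq_refl Reidx_Ide Reidx_Fib I graph_le[OF f]\<close>)
  then have "Leq R A Y (RComp R A X Y (graph R f) \<alpha>) (Reidx R f (Ide (Base R) Y) \<alpha>)"
    using RIde_RComp ob \<alpha> by simp
  then have "Leq R A B (RComp R A Y B (RComp R A X Y (graph R f) \<alpha>) (cograph R g))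
      (Reidx R f g (RComp R X Y Y \<alpha> (RIde R Y)))"
    by (intro RComp_Reidx[OF f I(2) g])
      (use assms ob in \<open>simp_all add: graph_Fib cograph_Fib RComp_Fib RIde_Fib cograph_le\<close>)
  then show ?thesis using RComp_RIde ob \<alpha> by simp
qed

text \<open>Composing with \<open>cograph R f\<close> and \<open>graph R g\<close> is left adjoint
  to \<open>Reidx R f g\<close>. From right to left the given cell is pasted between those that
  remove a cograph and a graph; from left to right \<open>\<alpha>\<close> is pasted between those
  that insert them. This is what makes the condition in \<open>em_fibre\<close> tractable.\<close>

lemma RComp_graph_le_iff:
  assumes f: "f \<in> hom (Base R) A X" and g: "g \<in> hom (Base R) B Y"
    and \<alpha>: "\<alpha> \<in> Fib R A B" and \<beta>: "\<beta> \<in> Fib R X Y"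
  shows "Leq R X Y (RComp R X B Y (RComp R X A B (cograph R f) \<alpha>) (graph R g)) \<beta> \<longleftrightarrow>
    Leq R A B \<alpha> (Reidx R f g \<beta>)"
proof
  have ob: "A \<in> Ob (Base R)" "B \<in> Ob (Base R)" "X \<in> Ob (Base R)" "Y \<in> Ob (Base R)"
    using assms base_facts by meson+
  note I = ob[THEN base.Ide_hom]
  note fib = graph_Fib[OF f] cograph_Fib[OF f] graph_Fib[OF g] cograph_Fib[OF g]
  {
    assume *: "Leq R A B \<alpha> (Reidx R f g \<beta>)"
    have "Leq R X B (RComp R X A B (cograph R f) \<alpha>)
        (Reidx R (Ide (Base R) X) g (RComp R X X Y (RIde R X) \<beta>))"
      by (rule RComp_Reidx[OF I(3) f g])
        (use assms ob fib * in \<open>simp_all add: RIde_Fib Leq_refl Reidx_Fib I cograph_eq\<close>)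
    then have "Leq R X B (RComp R X A B (cograph R f) \<alpha>) (Reidx R (Ide (Base R) X) g \<beta>)"
      using RIde_RComp ob \<beta> by simp
    then have "Leq R X Y (RComp R X B Y (RComp R X A B (cograph R f) \<alpha>) (graph R g))
        (Reidx R (Ide (Base R) X) (Ide (Base R) Y) (RComp R X Y Y \<beta> (RIde R Y)))"
      by (intro RComp_Reidx[OF I(3) g I(4)])
        (use assms ob fib in \<open>simp_all add: RComp_Fib RIde_Fib Leq_refl Reidx_Fib I graph_eq\<close>)
    then show "Leq R X Y (RComp R X B Y (RComp R X A B (cograph R f) \<alpha>) (graph R g)) \<beta>"
      using RComp_RIde Reidx_Ide ob \<beta> by simp
  }
  assume *: "Leq R X Y (RComp R X B Y (RComp R X A B (cograph R f) \<alpha>) (graph R g)) \<beta>"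
  have "Leq R A B (RComp R A A B (RIde R A) \<alpha>)
      (Reidx R f (Ide (Base R) B) (RComp R X A B (cograph R f) \<alpha>))"
    by (rule RComp_Reidx[OF f I(1,2)])
      (use assms ob fib in \<open>simp_all add: RIde_Reidx_graph RIde_Fib Leq_refl Reidx_Ide\<close>)
  then have "Leq R A B \<alpha> (Reidx R f (Ide (Base R) B) (RComp R X A B (cograph R f) \<alpha>))"
    using RIde_RComp ob \<alpha> by simp
  then have "Leq R A B (RComp R A B B \<alpha> (RIde R B))
      (Reidx R f g (RComp R X B Y (RComp R X A B (cograph R f) \<alpha>) (graph R g)))"
    by (intro RComp_Reidx[OF f I(2) g])
      (use assms ob fib in \<open>simp_all add: RIde_Reidx_graph RIde_Fib RComp_Fib\<close>)
  then have "Leq R A B \<alpha> (Reidx R f g (RComp R X B Y (RComp R X A B (cograph R f) \<alpha>) (graph R g)))"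
    using RComp_RIde ob \<alpha> by simp
  moreover have "Leq R A B \<dots> (Reidx R f g \<beta>)"
    by (rule Reidx_mono[OF f g _ _ *]) (use ob fib \<alpha> \<beta> in \<open>simp_all add: RComp_Fib\<close>)
  ultimately show "Leq R A B \<alpha> (Reidx R f g \<beta>)"
    using Leq_trans[OF ob(1,2)] ob fib \<alpha> \<beta> f g by (meson RComp_Fib Reidx_Fib)
qed

section \<open>Graph kernels and their behaviour under composition\<close>

lemma graph_kernel_eq:
  assumes f: "f \<in> hom (Base R) X Y"
  shows "graph_kernel R X Y f = Reidx R f f (RIde R Y)"
proof -
  have ob: "X \<in> Ob (Base R)" "Y \<in> Ob (Base R)" using assms base_facts by meson+
  note I = ob[THEN base.Ide_hom]
  note fib = graph_Fib[OF f] cograph_Fib[OF f]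
  have "Leq R X X (RComp R X Y X (graph R f) (cograph R f)) (Reidx R f f (RIde R Y))"
    using graph_RComp_cograph_le_Reidx[OF f f RIde_Fib[OF ob(2)]] RComp_RIde ob fib by simp
  \<comment> \<open>The left factor \<open>RIde R X\<close> makes the claim a pasting of the cell
    that inserts \<open>graph R f\<close> with the one into \<open>cograph R f\<close>; both this
    factor and reindexing along identities disappear at the end.\<close>
  moreover have "Leq R X X (RComp R X X X (RIde R X) (Reidx R f f (RIde R Y)))
      (Reidx R (Ide (Base R) X) (Ide (Base R) X) (RComp R X Y X (graph R f) (cograph R f)))"
  proof -
    have "Reidx R f f (RIde R Y) = Reidx R f (Ide (Base R) X) (cograph R f)"
      using Reidx_Comp[OF f I(2) I(1) f RIde_Fib[OF ob(2)]] f
      by (simp add: cograph_eq base.Comp_Ide base.Ide_Comp)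
    then have "Leq R X X (Reidx R f f (RIde R Y)) (Reidx R f (Ide (Base R) X) (cograph R f))"
      using Leq_refl[OF ob(1,1) Reidx_Fib[OF f f RIde_Fib[OF ob(2)]]] by simp
    then show ?thesis
      by (intro RComp_Reidx[OF I(1) f I(1)])
        (use f ob fib in \<open>simp_all add: RIde_Reidx_graph RIde_Fib Reidx_Fib\<close>)
  qed
  ultimately show ?thesis
    using f ob fib by (simp add: graph_kernel_def Leq_antisym RIde_RComp Reidx_Ide
        RComp_Fib RIde_Fib Reidx_Fib)
qed

lemma graph_kernel_Fib: "f \<in> hom (Base R) X Y \<Longrightarrow> graph_kernel R X Y f \<in> Fib R X X"
  using base_facts by (metis graph_kernel_eq)

lemma graph_kernel_comp:
  assumes f: "f \<in> hom (Base R) X Y" and g: "g \<in> hom (Base R) Y Z"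
  shows "graph_kernel R X Z (g \<cdot> f) = Reidx R f f (graph_kernel R Y Z g)"
  using assms Reidx_Comp[OF f g f g RIde_Fib] base_facts
  by (simp add: graph_kernel_eq[OF base.Comp_hom[OF f g]] graph_kernel_eq[OF g])

lemma graph_kernel_comp_mono:
  assumes f: "f \<in> hom (Base R) X Y" and g: "g \<in> hom (Base R) Y Z"
  shows "Leq R X X (graph_kernel R X Y f) (graph_kernel R X Z (g \<cdot> f))"
  unfolding graph_kernel_comp[OF f g] unfolding graph_kernel_eq[OF f] graph_kernel_eq[OF g]
  by (rule Reidx_mono[OF f f]) (use f g base_facts Reidx_RIde in \<open>meson\<close>)+

text \<open>Composing \<open>i\<close> with its inverse can only enlarge the kernel, and the kernel
  of an identity arrow is the identity relation. The other inequality is laxness of reindexing on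
  identities.\<close>

lemma graph_kernel_iso:
  assumes "inverse_arrows (Base R) X Y i j"
  shows "graph_kernel R X Y i = RIde R X"
proof -
  have i: "i \<in> hom (Base R) X Y" and j: "j \<in> hom (Base R) Y X" and ji: "j \<cdot> i = Ide (Base R) X"
    using assms by (auto simp: inverse_arrows_def)
  have X: "X \<in> Ob (Base R)" using i base_facts by meson
  have "graph_kernel R X X (Ide (Base R) X) = RIde R X"
    using X by (simp add: graph_kernel_eq base.Ide_hom Reidx_Ide RIde_Fib)
  then have "Leq R X X (graph_kernel R X Y i) (RIde R X)"
    using graph_kernel_comp_mono[OF i j] ji by simp
  moreover have "Leq R X X (RIde R X) (graph_kernel R X Y i)"
    using Reidx_RIde[OF i] graph_kernel_eq[OF i] by simp
  ultimately show ?thesis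
    using Leq_antisym X graph_kernel_Fib[OF i] RIde_Fib by metis
qed

lemma equivalence_graph_kernel:
  assumes f: "f \<in> hom (Base R) X Y"
  shows "equivalence_relation R X (graph_kernel R X Y f)"
proof -
  have ob: "X \<in> Ob (Base R)" "Y \<in> Ob (Base R)" using assms base_facts by meson+
  show ?thesis
    unfolding equivalence_relation_def graph_kernel_eq[OF f]
    using f ob Reidx_RIde[OF f] Reidx_RConv[OF f f RIde_Fib] Reidx_RComp[OF f f f RIde_Fib RIde_Fib]
    by (auto simp: Reidx_Fib RIde_Fib RConv_RIde RComp_RIde)
qed

text \<open>The isomorphism leaves the kernel of \<open>q\<close> unchanged, and
  \<open>h \<mapsto> h \<cdot> j\<close> matches the factorizations through \<open>q\<close> with
  those through \<open>i \<cdot> q\<close>.\<close>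

lemma quotient_arrow_of_iso_comp:
  assumes q: "quotient_arrow_of R X \<rho> W q" and ij: "inverse_arrows (Base R) W W' i j"
  shows "quotient_arrow_of R X \<rho> W' (i \<cdot> q)"
proof -
  note qD = quotient_arrow_ofD[OF q]
  have i: "i \<in> hom (Base R) W W'" and j: "j \<in> hom (Base R) W' W"
    and ji: "j \<cdot> i = Ide (Base R) W" and ij': "i \<cdot> j = Ide (Base R) W'"
    using ij by (auto simp: inverse_arrows_def)
  have iq: "i \<cdot> q \<in> hom (Base R) X W'" using base.Comp_hom qD i by meson
  have "graph_kernel R X W' (i \<cdot> q) = graph_kernel R X W q"
    using graph_kernel_comp[OF qD(1) i] graph_kernel_iso[OF ij] graph_kernel_eq[OF qD(1)] by simp
  moreover have "\<exists>!h. h \<in> hom (Base R) W' Z \<and> f = h \<cdot> (i \<cdot> q)"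
    if Z: "Z \<in> Ob (Base R)" and f: "f \<in> hom (Base R) X Z"
      and le: "Leq R X X \<rho> (graph_kernel R X Z f)" for Z f
  proof -
    obtain h where h: "h \<in> hom (Base R) W Z" "f = h \<cdot> q"
      and u: "\<And>h'. h' \<in> hom (Base R) W Z \<Longrightarrow> f = h' \<cdot> q \<Longrightarrow> h' = h"
      using quotient_arrow_of_factor[OF q Z f le] by metis
    have "(h \<cdot> j) \<cdot> (i \<cdot> q) = f"
      using base.Comp_assoc[OF iq j h(1)] base.Comp_assoc[OF qD(1) i j] ji h base.Ide_Comp[OF qD(1)]
      by simp
    moreover have "h' = h \<cdot> j" if h': "h' \<in> hom (Base R) W' Z" "f = h' \<cdot> (i \<cdot> q)" for h'
    proof -
      have "h' \<cdot> i = h"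
        using u[of "h' \<cdot> i"] base.Comp_hom[OF i h'(1)] base.Comp_assoc[OF qD(1) i h'(1)] h'(2)
        by simp
      then show ?thesis
        using base.Comp_assoc[OF j i h'(1)] ij' base.Comp_Ide[OF h'(1)] by simp
    qed
    ultimately show ?thesis using base.Comp_hom[OF j h(1)] by metis
  qed
  ultimately show ?thesis
    using iq qD(2) unfolding quotient_arrow_of_def by simp
qed

text \<open>By descent \<open>\<alpha>\<close> is recovered from \<open>?\<alpha>\<close> by
  composing with the cograph and the graph of \<open>q\<close>. Since \<open>?\<alpha>\<close> lies
  below \<open>Reidx R q q \<alpha>\<close>, hence below \<open>Reidx R q q \<beta>\<close>, the
  adjunction gives the claim.\<close>

lemma descent_Reidx_reflects:
  assumes q: "q \<in> hom (Base R) X W" and d: "descent R X W q"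
    and \<alpha>: "\<alpha> \<in> Fib R W W" and \<beta>: "\<beta> \<in> Fib R W W"
    and le: "Leq R X X (Reidx R q q \<alpha>) (Reidx R q q \<beta>)"
  shows "Leq R W W \<alpha> \<beta>"
proof -
  have ob: "X \<in> Ob (Base R)" "W \<in> Ob (Base R)" using q base_facts by meson+
  note fib = graph_Fib[OF q] cograph_Fib[OF q]
  let ?G = "graph R q" and ?H = "cograph R q"
  let ?\<alpha> = "RComp R X W X (RComp R X W W ?G \<alpha>) ?H"
  have 1: "?\<alpha> \<in> Fib R X X" using ob fib \<alpha> by (simp add: RComp_Fib)
  have "Leq R X X ?\<alpha> (Reidx R q q \<beta>)"
    using Leq_trans[OF ob(1) ob(1) 1 Reidx_Fib[OF q q \<alpha>] Reidx_Fib[OF q q \<beta>]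
        graph_RComp_cograph_le_Reidx[OF q q \<alpha>] le] .
  then have "Leq R W W (RComp R W X W (RComp R W X X ?H ?\<alpha>) ?G) \<beta>"
    using RComp_graph_le_iff[OF q q 1 \<beta>] by simp
  \<comment> \<open>Reassociation brings a cograph next to a graph on either side of
    \<open>\<alpha>\<close>, and descent collapses each pair to the identity relation.\<close>
  moreover have "RComp R W X W (RComp R W X X ?H ?\<alpha>) ?G = \<alpha>"
  proof -
    have "RComp R W X X ?H ?\<alpha> = RComp R W W X (RComp R W X W ?H (RComp R X W W ?G \<alpha>)) ?H"
      by (rule RComp_assoc) (use ob fib \<alpha> in \<open>simp_all add: RComp_Fib\<close>)
    also have "RComp R W X W ?H (RComp R X W W ?G \<alpha>) = RComp R W W W (RComp R W X W ?H ?G) \<alpha>"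
      by (rule RComp_assoc) (use ob fib \<alpha> in \<open>simp_all add: RComp_Fib\<close>)
    also have "\<dots> = \<alpha>" using d ob \<alpha> by (simp add: descent_def RIde_RComp)
    also have "RComp R W X W (RComp R W W X \<alpha> ?H) ?G = RComp R W W W \<alpha> (RComp R W X W ?H ?G)"
      by (rule RComp_assoc[symmetric]) (use ob fib \<alpha> in \<open>simp_all add: RComp_Fib\<close>)
    also have "\<dots> = \<alpha>" using d ob \<alpha> by (simp add: descent_def RComp_RIde)
    finally show ?thesis .
  qed
  ultimately show ?thesis by simp
qed

end

section \<open>Extensional doctrines with quotients\<close>

locale extensional_doctrine_with_quotients = relational_doctrine +
  assumes ext: "extensional R" and quot: "has_quotients R"
begin

text \<open>Pasting the hypothesis with the cell of \<open>graph R g\<close> puts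
  \<open>graph R g\<close> below \<open>graph R f\<close>. The converse of the hypothesis gives the
  opposite inequality, so extensionality applies.\<close>

lemma arrow_eqI:
  assumes f: "f \<in> hom (Base R) X Y" and g: "g \<in> hom (Base R) X Y"
    and le: "Leq R X X (RIde R X) (Reidx R f g (RIde R Y))"
  shows "f = g"
proof -
  have ob: "X \<in> Ob (Base R)" "Y \<in> Ob (Base R)" using f base_facts by meson+
  note I = ob[THEN base.Ide_hom]
  have graph_le: "Leq R X Y (graph R b) (graph R a)"
    if a: "a \<in> hom (Base R) X Y" and b: "b \<in> hom (Base R) X Y"
      and ab: "Leq R X X (RIde R X) (Reidx R a b (RIde R Y))" for a b
  proof -
    have "Leq R X Y (RComp R X X Y (RIde R X) (graph R b))
        (Reidx R a (Ide (Base R) Y) (RComp R Y Y Y (RIde R Y) (RIde R Y)))"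
      by (rule RComp_Reidx[OF a b I(2)])
        (use a b ob ab in \<open>simp_all add: RIde_Fib graph_Fib graph_le\<close>)
    then show ?thesis
      using graph_Fib[OF b] ob by (simp add: RIde_RComp RIde_Fib graph_eq[OF a])
  qed
  have "Leq R X X (RConv R X X (RIde R X)) (RConv R X X (Reidx R f g (RIde R Y)))"
    using RConv_mono[OF ob(1,1) _ _ le] ob RIde_Fib Reidx_Fib[OF f g] by blast
  then have "Leq R X X (RIde R X) (Reidx R g f (RIde R Y))"
    using ob by (simp add: RConv_RIde RConv_Reidx[OF f g RIde_Fib])
  then have "graph R f = graph R g"
    using graph_le[OF f g le] graph_le[OF g f] Leq_antisym[OF ob graph_Fib[OF f] graph_Fib[OF g]]
    by blast
  then show ?thesis using ext f g ob unfolding extensional_def by blast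
qed

text \<open>\<open>has_quotients\<close> provides one effective descent quotient of
  \<open>\<rho>\<close>. Every quotient arrow of \<open>\<rho>\<close> is isomorphic to it and so
  inherits effectiveness as well as the order reflection that descent yields.\<close>

lemma quotient_arrow_of_kernel:
  assumes eq: "equivalence_relation R X \<rho>" and q: "quotient_arrow_of R X \<rho> W q"
  shows "graph_kernel R X W q = \<rho>"
    and "\<And>\<alpha> \<beta>. \<lbrakk>\<alpha> \<in> Fib R W W; \<beta> \<in> Fib R W W;
      Leq R X X (Reidx R q q \<alpha>) (Reidx R q q \<beta>)\<rbrakk> \<Longrightarrow> Leq R W W \<alpha> \<beta>"
proof -
  note qD = quotient_arrow_ofD[OF q]
  obtain V p where p: "quotient_arrow_of R X \<rho> V p" "effective R X \<rho> V p" "descent R X V p"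
    using quot eq unfolding has_quotients_def by blast
  note pD = quotient_arrow_ofD[OF p(1)]
  obtain i j where inv: "inverse_arrows (Base R) V W i j" and qi: "q = i \<cdot> p"
    using quotient_arrow_of_unique[OF base_category p(1) q] by metis
  then have i: "i \<in> hom (Base R) V W" and j: "j \<in> hom (Base R) W V"
    and ij: "i \<cdot> j = Ide (Base R) W"
    by (auto simp: inverse_arrows_def)
  show "graph_kernel R X W q = \<rho>"
    using p(2) graph_kernel_comp[OF pD(1) i] graph_kernel_iso[OF inv] graph_kernel_eq[OF pD(1)] qi
    by (simp add: effective_def)
  fix \<alpha> \<beta>
  assume \<alpha>: "\<alpha> \<in> Fib R W W" and \<beta>: "\<beta> \<in> Fib R W W"
    and le: "Leq R X X (Reidx R q q \<alpha>) (Reidx R q q \<beta>)"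
  have W: "W \<in> Ob (Base R)" using i base_facts by meson
  have "Leq R X X (Reidx R p p (Reidx R i i \<alpha>)) (Reidx R p p (Reidx R i i \<beta>))"
    using le qi Reidx_Comp[OF pD(1) i pD(1) i] \<alpha> \<beta> by simp
  then have "Leq R V V (Reidx R i i \<alpha>) (Reidx R i i \<beta>)"
    using descent_Reidx_reflects[OF pD(1) p(3)] Reidx_Fib[OF i i] \<alpha> \<beta> by blast
  then have "Leq R W W (Reidx R j j (Reidx R i i \<alpha>)) (Reidx R j j (Reidx R i i \<beta>))"
    using Reidx_mono[OF j j] Reidx_Fib[OF i i] \<alpha> \<beta> by blast
  then show "Leq R W W \<alpha> \<beta>"
    using Reidx_Comp[OF j i j i \<alpha>] Reidx_Comp[OF j i j i \<beta>] ij Reidx_Ide W \<alpha> \<beta> by simp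
qed

text \<open>By effectiveness a quotient arrow determines its equivalence relation, so the
  existential in \<open>quotient_arrow\<close> can always be witnessed by the kernel.\<close>

lemma quotient_arrow_iff:
  "quotient_arrow R X W q \<longleftrightarrow> quotient_arrow_of R X (graph_kernel R X W q) W q"
  using quotient_arrow_of_kernel(1) equivalence_graph_kernel quotient_arrow_ofD(1)
  unfolding quotient_arrow_def by metis

text \<open>Any composite \<open>g \<cdot> q\<close> has a kernel above that of \<open>q\<close>, so
  it falls under the uniqueness of factorizations.\<close>

lemma quotient_arrow_epi:
  assumes q: "quotient_arrow R X W q"
    and g: "g \<in> hom (Base R) W Z" and h: "h \<in> hom (Base R) W Z" and eq: "g \<cdot> q = h \<cdot> q"
  shows "g = h"
proof -
  have k: "quotient_arrow_of R X (graph_kernel R X W q) W q"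
    using q quotient_arrow_iff by simp
  note kD = quotient_arrow_ofD[OF k]
  show ?thesis
    using quotient_arrow_of_epi[OF k graph_kernel_Fib[OF kD(1)] g h eq
        graph_kernel_comp_mono[OF kD(1) g]] .
qed

text \<open>The only candidate for a factorization of \<open>f\<close> is
  \<open>f \<cdot> s\<close>. Extensionality enters to show that it is one: the kernel inequality
  relates \<open>f\<close> and \<open>f \<cdot> (s \<cdot> q)\<close> as \<open>arrow_eqI\<close>
  requires.\<close>

lemma split_epi_quotient_arrow:
  assumes q: "q \<in> hom (Base R) X W" and s: "s \<in> hom (Base R) W X" and qs: "q \<cdot> s = Ide (Base R) W"
  shows "quotient_arrow R X W q"
  unfolding quotient_arrow_iff unfolding quotient_arrow_of_def
proof (intro conjI ballI impI)
  have ob: "X \<in> Ob (Base R)" "W \<in> Ob (Base R)" using q base_facts by meson+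
  note I = ob[THEN base.Ide_hom]
  show "q \<in> hom (Base R) X W" by (rule q)
  show "Leq R X X (graph_kernel R X W q) (graph_kernel R X W q)"
    using Leq_refl ob graph_kernel_Fib[OF q] by blast
  fix Z f
  assume Z: "Z \<in> Ob (Base R)" and f: "f \<in> hom (Base R) X Z"
    and le: "Leq R X X (graph_kernel R X W q) (graph_kernel R X Z f)"
  note sq = base.Comp_hom[OF q s] and fs = base.Comp_hom[OF s f]
  note fsq = base.Comp_hom[OF sq f]
  have qsq: "q \<cdot> (s \<cdot> q) = q" using base.Comp_assoc[OF q s q] qs base.Ide_Comp[OF q] by simp
  \<comment> \<open>The kernel inequality is reindexed along the identity on the left and
    \<open>s \<cdot> q\<close> on the right. The kernel of \<open>q\<close> is unaffected, because
    \<open>q \<cdot> (s \<cdot> q) = q\<close>.\<close>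
  have "Leq R X X (Reidx R (Ide (Base R) X) (s \<cdot> q) (Reidx R q q (RIde R W)))
      (Reidx R (Ide (Base R) X) (s \<cdot> q) (Reidx R f f (RIde R Z)))"
    by (rule Reidx_mono[OF I(1) sq])
      (use le ob Z q f in \<open>simp_all add: graph_kernel_eq Reidx_Fib RIde_Fib\<close>)
  then have "Leq R X X (Reidx R q q (RIde R W)) (Reidx R f (f \<cdot> (s \<cdot> q)) (RIde R Z))"
    using Reidx_Comp[OF I(1) q sq q RIde_Fib[OF ob(2)]] qsq
      Reidx_Comp[OF I(1) f sq f RIde_Fib[OF Z]] base.Comp_Ide[OF f] base.Comp_Ide[OF q] by simp
  then have "Leq R X X (RIde R X) (Reidx R f (f \<cdot> (s \<cdot> q)) (RIde R Z))"
    using Leq_trans[OF ob(1,1) RIde_Fib[OF ob(1)] Reidx_Fib[OF q q RIde_Fib[OF ob(2)]]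
        Reidx_Fib[OF f fsq RIde_Fib[OF Z]] Reidx_RIde[OF q]] by blast
  then have "f = (f \<cdot> s) \<cdot> q"
    using arrow_eqI[OF f fsq] base.Comp_assoc[OF q s f] by simp
  moreover have "h = f \<cdot> s" if "h \<in> hom (Base R) W Z" "f = h \<cdot> q" for h
    using that base.Comp_assoc[OF s q that(1)] qs base.Comp_Ide[OF that(1)] by simp
  ultimately show "\<exists>!h. h \<in> hom (Base R) W Z \<and> f = h \<cdot> q" using fs by blast
qed

text \<open>An arrow compatible with the kernel of \<open>q \<cdot> p\<close> is compatible with the
  smaller kernel of \<open>p\<close>, hence of the form \<open>h \<cdot> p\<close>. As reindexing
  along \<open>p\<close> reflects the order, the kernel of \<open>q\<close> lies below that of
  \<open>h\<close>, which therefore factors through \<open>q\<close>.\<close>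

lemma quotient_arrow_comp:
  assumes p: "quotient_arrow R X Y p" and q: "quotient_arrow R Y W q"
  shows "quotient_arrow R X W (q \<cdot> p)"
  unfolding quotient_arrow_iff unfolding quotient_arrow_of_def
proof (intro conjI ballI impI)
  have p': "quotient_arrow_of R X (graph_kernel R X Y p) Y p"
    and q': "quotient_arrow_of R Y (graph_kernel R Y W q) W q"
    using p q quotient_arrow_iff by simp_all
  note ph = quotient_arrow_ofD(1)[OF p'] and qh = quotient_arrow_ofD(1)[OF q']
  show qp: "q \<cdot> p \<in> hom (Base R) X W" using base.Comp_hom[OF ph qh] .
  have ob: "X \<in> Ob (Base R)" "Y \<in> Ob (Base R)" "W \<in> Ob (Base R)" using ph qh base_facts by meson+
  show "Leq R X X (graph_kernel R X W (q \<cdot> p)) (graph_kernel R X W (q \<cdot> p))"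
    using Leq_refl ob graph_kernel_Fib[OF qp] by blast
  fix Z f
  assume Z: "Z \<in> Ob (Base R)" and f: "f \<in> hom (Base R) X Z"
    and le: "Leq R X X (graph_kernel R X W (q \<cdot> p)) (graph_kernel R X Z f)"
  have "Leq R X X (graph_kernel R X Y p) (graph_kernel R X Z f)"
    using Leq_trans[OF ob(1,1) graph_kernel_Fib[OF ph] graph_kernel_Fib[OF qp] graph_kernel_Fib[OF f]
        graph_kernel_comp_mono[OF ph qh] le] .
  then obtain h where h: "h \<in> hom (Base R) Y Z" "f = h \<cdot> p"
    using quotient_arrow_of_factor[OF p' Z f] by metis
  have "Leq R Y Y (graph_kernel R Y W q) (graph_kernel R Y Z h)"
    using quotient_arrow_of_kernel(2)[OF equivalence_graph_kernel[OF ph] p'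
        graph_kernel_Fib[OF qh] graph_kernel_Fib[OF h(1)]] le h(2)
      graph_kernel_comp[OF ph qh] graph_kernel_comp[OF ph h(1)] by simp
  then obtain k where k: "k \<in> hom (Base R) W Z" "h = k \<cdot> q"
    using quotient_arrow_of_factor[OF q' Z h(1)] by metis
  have "f = k \<cdot> (q \<cdot> p)" using h(2) k(2) base.Comp_assoc[OF ph qh k(1)] by simp
  moreover have "l = k" if l: "l \<in> hom (Base R) W Z" "f = l \<cdot> (q \<cdot> p)" for l
  proof -
    have "(l \<cdot> q) \<cdot> p = h \<cdot> p" using l h(2) base.Comp_assoc[OF ph qh l(1)] by simp
    then have "l \<cdot> q = k \<cdot> q" using quotient_arrow_epi[OF p base.Comp_hom[OF qh l(1)] h(1)] k(2) by simp
    then show ?thesis using quotient_arrow_epi[OF q l(1) k(1)] by simp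
  qed
  ultimately show "\<exists>!k. k \<in> hom (Base R) W Z \<and> f = k \<cdot> (q \<cdot> p)" using k(1) by blast
qed

end

section \<open>Quotients of algebras\<close>

lemma em_hom_iff:
  "(A, f, B) \<in> hom (em_category C T) (X, a) (Y, b) \<longleftrightarrow>
    A = (X, a) \<and> B = (Y, b) \<and> (X, a) \<in> em_algebras C T \<and> (Y, b) \<in> em_algebras C T \<and>
    f \<in> hom C X Y \<and> f \<bullet>\<^bsub>C\<^esub> a = b \<bullet>\<^bsub>C\<^esub> FAr (MFun T) f"
  unfolding hom_def[of "em_category C T"] by (auto simp: em_category_def)

lemma em_homE:
  assumes "h \<in> hom (em_category C T) (X, a) (Y, b)"
  obtains f where "h = ((X, a), f, (Y, b))" "(X, a) \<in> em_algebras C T" "(Y, b) \<in> em_algebras C T"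
    "f \<in> hom C X Y" "f \<bullet>\<^bsub>C\<^esub> a = b \<bullet>\<^bsub>C\<^esub> FAr (MFun T) f"
  using assms that by (cases h) (simp add: em_hom_iff)

lemma em_category_simps [simp]:
  "Ob (em_category C T) = em_algebras C T"
  "Ide (em_category C T) (X, a) = ((X, a), Ide C X, (X, a))"
  "Comp (em_category C T) (B', g, D) (A, f, B) = (A, g \<bullet>\<^bsub>C\<^esub> f, D)"
  by (simp_all add: em_category_def)

lemma em_doctrine_simps [simp]:
  "Base (em_doctrine R T) = em_category (Base R) T"
  "Fib (em_doctrine R T) = em_fibre R T"
  "Leq (em_doctrine R T) (X, a) (Y, b) = Leq R X Y"
  "Reidx (em_doctrine R T) (A, f, B) (A', g, B') = Reidx R f g"
  "RComp (em_doctrine R T) (X, a) (Y, b) (Z, c) = RComp R X Y Z"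
  "RIde (em_doctrine R T) (X, a) = RIde R X"
  "RConv (em_doctrine R T) (X, a) (Y, b) = RConv R X Y"
  by (simp_all add: em_doctrine_def)

lemma em_graph_kernel:
  "f \<in> hom (Base R) X Y \<Longrightarrow>
    graph_kernel (em_doctrine R T) (X, a) (Y, b) ((X, a), f, (Y, b)) = graph_kernel R X Y f"
  by (simp add: graph_kernel_def graph_def cograph_def hom_Dom_Cod em_category_def)

lemma em_algebrasD:
  assumes "(X, a) \<in> em_algebras C T"
  shows "X \<in> Ob C" "a \<in> hom C (FOb (MFun T) X) X" "a \<bullet>\<^bsub>C\<^esub> Unit T X = Ide C X"
    "a \<bullet>\<^bsub>C\<^esub> Mult T X = a \<bullet>\<^bsub>C\<^esub> FAr (MFun T) a"
  using assms by (auto simp: em_algebras_def)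

lemma em_equivalence_iff:
  "equivalence_relation (em_doctrine R T) (X, a) \<rho> \<longleftrightarrow>
    (X, a) \<in> em_algebras (Base R) T \<and> \<rho> \<in> em_fibre R T (X, a) (X, a) \<and>
    equivalence_relation R X \<rho>"
  by (auto simp: equivalence_relation_def em_fibre_def em_algebras_def)

section \<open>Monads on an extensional doctrine with quotients\<close>

locale monad_with_quotients = extensional_doctrine_with_quotients +
  fixes T
  assumes eqrd: "eqrd_monad R T"
begin

abbreviation "T\<^sub>0 \<equiv> FOb (MFun T)"
abbreviation "T\<^sub>1 \<equiv> FAr (MFun T)"
abbreviation "\<eta> \<equiv> Unit T"
abbreviation "\<mu> \<equiv> Mult T"

lemma rd_monad: "rd_monad R T"
  using eqrd by (simp add: eqrd_monad_def)

lemma one_arrow: "one_arrow R R (MFun T)"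
  using rd_monad rd_monad_def two_arrow_def by blast

lemma T_functor:
  shows T_Ob: "X \<in> Ob (Base R) \<Longrightarrow> T\<^sub>0 X \<in> Ob (Base R)"
    and T_hom: "f \<in> hom (Base R) X Y \<Longrightarrow> T\<^sub>1 f \<in> hom (Base R) (T\<^sub>0 X) (T\<^sub>0 Y)"
    and T_Ide: "X \<in> Ob (Base R) \<Longrightarrow> T\<^sub>1 (Ide (Base R) X) = Ide (Base R) (T\<^sub>0 X)"
    and T_Comp: "f \<in> hom (Base R) X Y \<Longrightarrow> g \<in> hom (Base R) Y Z \<Longrightarrow>
      T\<^sub>1 (g \<cdot> f) = T\<^sub>1 g \<cdot> T\<^sub>1 f"
  using one_arrow.base_functor[OF one_arrow] unfolding is_functor_def by blast+

lemma eta_two_arrow: "two_arrow R R arrow1_id (MFun T) \<eta>"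
  and mu_two_arrow: "two_arrow R R (arrow1_comp (MFun T) (MFun T)) (MFun T) \<mu>"
  using rd_monad unfolding rd_monad_def by blast+

lemma eta_hom: "X \<in> Ob (Base R) \<Longrightarrow> \<eta> X \<in> hom (Base R) X (T\<^sub>0 X)"
  and eta_natural: "f \<in> hom (Base R) X Y \<Longrightarrow> T\<^sub>1 f \<cdot> \<eta> X = \<eta> Y \<cdot> f"
  using two_arrow.component[OF eta_two_arrow] two_arrow.natural[OF eta_two_arrow]
  by (auto simp: arrow1_id_def)

lemma mu_hom: "X \<in> Ob (Base R) \<Longrightarrow> \<mu> X \<in> hom (Base R) (T\<^sub>0 (T\<^sub>0 X)) (T\<^sub>0 X)"
  and mu_natural: "f \<in> hom (Base R) X Y \<Longrightarrow> T\<^sub>1 f \<cdot> \<mu> X = \<mu> Y \<cdot> T\<^sub>1 (T\<^sub>1 f)"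
  using two_arrow.component[OF mu_two_arrow] two_arrow.natural[OF mu_two_arrow]
  by (auto simp: arrow1_comp_def)

text \<open>Kernels are reindexed identity relations, and a 1-arrow preserves both reindexing and
  identity relations strictly.\<close>

lemma T_graph_kernel:
  assumes f: "f \<in> hom (Base R) X Y"
  shows "FRel (MFun T) X X (graph_kernel R X Y f) = graph_kernel R (T\<^sub>0 X) (T\<^sub>0 Y) (T\<^sub>1 f)"
  using one_arrow.FRel_natural[OF one_arrow f f RIde_Fib] one_arrow.FRel_RIde[OF one_arrow]
    base.hom_Ob[OF f]
  by (simp add: graph_kernel_eq[OF f] graph_kernel_eq[OF T_hom[OF f]])

lemma T_equivalence:
  assumes "equivalence_relation R X \<rho>"
  shows "equivalence_relation R (T\<^sub>0 X) (FRel (MFun T) X X \<rho>)"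
proof -
  interpret M: one_arrow R R "MFun T" by (rule one_arrow)
  have X: "X \<in> Ob (Base R)" and \<rho>: "\<rho> \<in> Fib R X X" "Leq R X X (RIde R X) \<rho>"
    "Leq R X X (RConv R X X \<rho>) \<rho>" "Leq R X X (RComp R X X X \<rho> \<rho>) \<rho>"
    using assms by (auto simp: equivalence_relation_def)
  show ?thesis
    unfolding equivalence_relation_def
    using M.FRel_mono[OF X X RIde_Fib[OF X] \<rho>(1,2)] M.FRel_mono[OF X X RConv_Fib[OF X X \<rho>(1)] \<rho>(1,3)]
      M.FRel_mono[OF X X RComp_Fib[OF X X X \<rho>(1,1)] \<rho>(1,4)]
    by (simp add: M.FRel_RIde[OF X] M.FRel_RConv[OF X X \<rho>(1)] M.FRel_RComp[OF X X X \<rho>(1,1)]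
        T_Ob[OF X] M.FRel_Fib[OF X X \<rho>(1)])
qed

lemma T_quotient_arrow_of:
  "equivalence_relation R X \<rho> \<Longrightarrow> quotient_arrow_of R X \<rho> W q \<Longrightarrow>
    quotient_arrow_of R (T\<^sub>0 X) (FRel (MFun T) X X \<rho>) (T\<^sub>0 W) (T\<^sub>1 q)"
  using eqrd unfolding eqrd_monad_def preserves_quotients_def by blast

lemma T_quotient_arrow: "quotient_arrow R X W q \<Longrightarrow> quotient_arrow R (T\<^sub>0 X) (T\<^sub>0 W) (T\<^sub>1 q)"
  using T_equivalence T_quotient_arrow_of unfolding quotient_arrow_def by blast

lemma em_fibre_iff:
  assumes "(X, a) \<in> em_algebras (Base R) T" "(Y, b) \<in> em_algebras (Base R) T"
  shows "\<alpha> \<in> em_fibre R T (X, a) (Y, b) \<longleftrightarrow>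
    \<alpha> \<in> Fib R X Y \<and> Leq R (T\<^sub>0 X) (T\<^sub>0 Y) (FRel (MFun T) X Y \<alpha>) (Reidx R a b \<alpha>)"
  using RComp_graph_le_iff[OF em_algebrasD(2)[OF assms(1)] em_algebrasD(2)[OF assms(2)]]
    one_arrow.FRel_Fib[OF one_arrow em_algebrasD(1)[OF assms(1)] em_algebrasD(1)[OF assms(2)]]
  by (auto simp: em_fibre_def)

lemma em_category: "category (em_category (Base R) T)"
proof
  fix f assume "f \<in> Ar (em_category (Base R) T)"
  then show "Dom (em_category (Base R) T) f \<in> Ob (em_category (Base R) T)"
    and "Cod (em_category (Base R) T) f \<in> Ob (em_category (Base R) T)"
    by (auto simp: em_category_def)
next
  fix A assume "A \<in> Ob (em_category (Base R) T)"
  then obtain X a where A: "A = (X, a)" "(X, a) \<in> em_algebras (Base R) T" by (cases A) auto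
  note aD = em_algebrasD[OF A(2)]
  show "Ide (em_category (Base R) T) A \<in> hom (em_category (Base R) T) A A"
    using A aD by (simp add: em_hom_iff base.Ide_hom base.Ide_Comp base.Comp_Ide T_Ide)
next
  fix f g and A B D :: "'a \<times> 'b"
  assume f: "f \<in> hom (em_category (Base R) T) A B" and g: "g \<in> hom (em_category (Base R) T) B D"
  obtain X a Y b Z c where ABD: "A = (X, a)" "B = (Y, b)" "D = (Z, c)" by fastforce
  obtain f' where f': "f = ((X, a), f', (Y, b))" "(X, a) \<in> em_algebras (Base R) T"
    "(Y, b) \<in> em_algebras (Base R) T" "f' \<in> hom (Base R) X Y" "f' \<cdot> a = b \<cdot> T\<^sub>1 f'"
    using em_homE f ABD by metis
  obtain g' where g': "g = ((Y, b), g', (Z, c))" "(Z, c) \<in> em_algebras (Base R) T"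
    "g' \<in> hom (Base R) Y Z" "g' \<cdot> b = c \<cdot> T\<^sub>1 g'"
    using em_homE g ABD by metis
  note a = em_algebrasD(2)[OF f'(2)] and b = em_algebrasD(2)[OF f'(3)]
    and c = em_algebrasD(2)[OF g'(2)]
  have "(g' \<cdot> f') \<cdot> a = c \<cdot> T\<^sub>1 (g' \<cdot> f')"
    using base.Comp_assoc[OF a f'(4) g'(3)] base.Comp_assoc[OF T_hom[OF f'(4)] b g'(3)]
      base.Comp_assoc[OF T_hom[OF f'(4)] T_hom[OF g'(3)] c] f'(5) g'(4) T_Comp[OF f'(4) g'(3)]
    by simp
  then show "Comp (em_category (Base R) T) g f \<in> hom (em_category (Base R) T) A D"
    using ABD f' g' base.Comp_hom[OF f'(4) g'(3)] by (simp add: em_hom_iff)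
next
  fix f and A B :: "'a \<times> 'b"
  assume f: "f \<in> hom (em_category (Base R) T) A B"
  obtain X a Y b where AB: "A = (X, a)" "B = (Y, b)" by fastforce
  obtain f' where f': "f = ((X, a), f', (Y, b))" "f' \<in> hom (Base R) X Y"
    using em_homE f AB by metis
  show "Comp (em_category (Base R) T) f (Ide (em_category (Base R) T) A) = f"
    and "Comp (em_category (Base R) T) (Ide (em_category (Base R) T) B) f = f"
    using f' AB by (simp_all add: base.Comp_Ide base.Ide_Comp)
next
  fix f g h and A B D E :: "'a \<times> 'b"
  assume *: "f \<in> hom (em_category (Base R) T) A B" "g \<in> hom (em_category (Base R) T) B D"
    "h \<in> hom (em_category (Base R) T) D E"
  obtain X a Y b Z c V d where O: "A = (X, a)" "B = (Y, b)" "D = (Z, c)" "E = (V, d)"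
    by fastforce
  obtain f' where f': "f = ((X, a), f', (Y, b))" "f' \<in> hom (Base R) X Y"
    using em_homE *(1) O by metis
  obtain g' where g': "g = ((Y, b), g', (Z, c))" "g' \<in> hom (Base R) Y Z"
    using em_homE *(2) O by metis
  obtain h' where h': "h = ((Z, c), h', (V, d))" "h' \<in> hom (Base R) Z V"
    using em_homE *(3) O by metis
  show "Comp (em_category (Base R) T) h (Comp (em_category (Base R) T) g f) =
      Comp (em_category (Base R) T) (Comp (em_category (Base R) T) h g) f"
    using f' g' h' base.Comp_assoc[OF f'(2) g'(2) h'(2)] by simp
qed

lemma free_algebra:
  assumes X: "X \<in> Ob (Base R)"
  shows "(T\<^sub>0 X, \<mu> X) \<in> em_algebras (Base R) T"
  using rd_monad.left_unit[OF rd_monad X] rd_monad.mult_assoc[OF rd_monad X] T_Ob[OF X] mu_hom[OF X]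
  by (simp add: em_algebras_def)

text \<open>The functor takes the kernel of \<open>f\<close> to that of \<open>T\<^sub>1 f\<close>,
  which lies below the kernel of \<open>b \<cdot> T\<^sub>1 f = f \<cdot> a\<close>. The latter is
  the kernel of \<open>f\<close> reindexed along \<open>a\<close>.\<close>

lemma em_graph_kernel_fibre:
  assumes "((X, a), f, (Y, b)) \<in> hom (em_category (Base R) T) (X, a) (Y, b)"
  shows "graph_kernel R X Y f \<in> em_fibre R T (X, a) (X, a)"
proof -
  have alg: "(X, a) \<in> em_algebras (Base R) T" "(Y, b) \<in> em_algebras (Base R) T"
    and f: "f \<in> hom (Base R) X Y" and fa: "f \<cdot> a = b \<cdot> T\<^sub>1 f"
    using assms by (auto simp: em_hom_iff)
  note a = em_algebrasD(2)[OF alg(1)] and b = em_algebrasD(2)[OF alg(2)]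
  have "Leq R (T\<^sub>0 X) (T\<^sub>0 X) (graph_kernel R (T\<^sub>0 X) (T\<^sub>0 Y) (T\<^sub>1 f))
      (graph_kernel R (T\<^sub>0 X) Y (b \<cdot> T\<^sub>1 f))"
    using graph_kernel_comp_mono[OF T_hom[OF f] b] .
  also have "graph_kernel R (T\<^sub>0 X) Y (b \<cdot> T\<^sub>1 f) = Reidx R a a (graph_kernel R X Y f)"
    using graph_kernel_comp[OF a f] fa by simp
  finally show ?thesis
    using em_fibre_iff[OF alg(1,1)] graph_kernel_Fib[OF f] T_graph_kernel[OF f] by simp
qed

text \<open>The factorization \<open>h\<close> found in the base is the only candidate. It is a
  homomorphism because \<open>T\<^sub>1 q\<close> is again a quotient arrow and can be cancelled
  from the right of \<open>h \<cdot> c\<close> and \<open>z \<cdot> T\<^sub>1 h\<close>.\<close>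

lemma em_quotient_arrow_ofI:
  assumes q: "quotient_arrow_of R X \<rho> W q" and eq: "equivalence_relation R X \<rho>"
    and hom: "((X, a), q, (W, c)) \<in> hom (em_category (Base R) T) (X, a) (W, c)"
  shows "quotient_arrow_of (em_doctrine R T) (X, a) \<rho> (W, c) ((X, a), q, (W, c))"
  unfolding quotient_arrow_of_def em_doctrine_simps
proof (intro conjI ballI impI hom)
  have alg: "(X, a) \<in> em_algebras (Base R) T" "(W, c) \<in> em_algebras (Base R) T"
    and qh: "q \<in> hom (Base R) X W" and qa: "q \<cdot> a = c \<cdot> T\<^sub>1 q"
    using hom by (auto simp: em_hom_iff)
  note a = em_algebrasD(2)[OF alg(1)] and c = em_algebrasD(2)[OF alg(2)]
  have Tq: "quotient_arrow R (T\<^sub>0 X) (T\<^sub>0 W) (T\<^sub>1 q)"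
    using T_quotient_arrow q eq unfolding quotient_arrow_def by blast
  show "Leq R X X \<rho> (graph_kernel (em_doctrine R T) (X, a) (W, c) ((X, a), q, (W, c)))"
    using quotient_arrow_ofD(2)[OF q] by (simp add: em_graph_kernel[OF qh])
  fix A f
  assume A: "A \<in> Ob (em_category (Base R) T)" and f: "f \<in> hom (em_category (Base R) T) (X, a) A"
    and le: "Leq R X X \<rho> (graph_kernel (em_doctrine R T) (X, a) A f)"
  obtain Z z where Z: "A = (Z, z)" by fastforce
  obtain f' where f': "f = ((X, a), f', (Z, z))" "(Z, z) \<in> em_algebras (Base R) T"
    "f' \<in> hom (Base R) X Z" "f' \<cdot> a = z \<cdot> T\<^sub>1 f'"
    using em_homE f Z by metis
  note z = em_algebrasD(1,2)[OF f'(2)]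
  have le': "Leq R X X \<rho> (graph_kernel R X Z f')"
    using le f' Z by (simp add: em_graph_kernel)
  obtain h where h: "h \<in> hom (Base R) W Z" "f' = h \<cdot> q"
    and u: "\<And>h'. h' \<in> hom (Base R) W Z \<Longrightarrow> f' = h' \<cdot> q \<Longrightarrow> h' = h"
    using quotient_arrow_of_factor[OF q z(1) f'(3) le'] by metis
  have "(h \<cdot> c) \<cdot> T\<^sub>1 q = (z \<cdot> T\<^sub>1 h) \<cdot> T\<^sub>1 q"
    using base.Comp_assoc[OF T_hom[OF qh] c h(1)] base.Comp_assoc[OF a qh h(1)] qa h(2) f'(4)
      base.Comp_assoc[OF T_hom[OF qh] T_hom[OF h(1)] z(2)] T_Comp[OF qh h(1)] by simp
  then have "h \<cdot> c = z \<cdot> T\<^sub>1 h"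
    using quotient_arrow_epi[OF Tq base.Comp_hom[OF c h(1)] base.Comp_hom[OF T_hom[OF h(1)] z(2)]]
    by blast
  then have "((W, c), h, (Z, z)) \<in> hom (em_category (Base R) T) (W, c) A"
    using Z alg f' h by (simp add: em_hom_iff)
  moreover have "f = Comp (em_category (Base R) T) ((W, c), h, (Z, z)) ((X, a), q, (W, c))"
    using f' h by simp
  moreover have "k = ((W, c), h, (Z, z))"
    if k: "k \<in> hom (em_category (Base R) T) (W, c) A"
      "f = Comp (em_category (Base R) T) k ((X, a), q, (W, c))" for k
  proof -
    obtain k' where k': "k = ((W, c), k', (Z, z))" "k' \<in> hom (Base R) W Z"
      using em_homE k(1) Z by metis
    then show ?thesis using u[of k'] k(2) f' by simp
  qed
  ultimately show "\<exists>!h. h \<in> hom (em_category (Base R) T) (W, c) A \<and>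
      f = Comp (em_category (Base R) T) h ((X, a), q, (W, c))"
    by blast
qed

text \<open>
  The quotient \<open>q : X \<rightarrow> W\<close> in the base lifts: \<open>q \<cdot> a\<close> is compatible with
  \<open>T \<rho>\<close> and \<open>T q\<close> is a quotient arrow, so \<open>q \<cdot> a\<close> factors as \<open>c \<cdot> T q\<close>. The algebra laws of
  \<open>c\<close> follow by cancelling \<open>q\<close> and \<open>T (T q)\<close>.
\<close>

lemma quotient_algebra:
  assumes alg: "(X, a) \<in> em_algebras (Base R) T" and \<rho>: "\<rho> \<in> em_fibre R T (X, a) (X, a)"
    and eq: "equivalence_relation R X \<rho>" and q: "quotient_arrow_of R X \<rho> W q"
  obtains c where "((X, a), q, (W, c)) \<in> hom (em_category (Base R) T) (X, a) (W, c)"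
proof -
  note aD = em_algebrasD[OF alg] and qh = quotient_arrow_ofD(1)[OF q]
  note X = aD(1) and a = aD(2) and W = base.hom_Ob(2)[OF qh]
  note qa = base.Comp_hom[OF a qh] and Tqh = T_hom[OF qh]
  have Q: "quotient_arrow R X W q" using q eq unfolding quotient_arrow_def by blast
  have TTQ: "quotient_arrow R (T\<^sub>0 (T\<^sub>0 X)) (T\<^sub>0 (T\<^sub>0 W)) (T\<^sub>1 (T\<^sub>1 q))"
    using Q T_quotient_arrow by blast
  have "graph_kernel R (T\<^sub>0 X) W (q \<cdot> a) = Reidx R a a \<rho>"
    using graph_kernel_comp[OF a qh] quotient_arrow_of_kernel(1)[OF eq q] by simp
  then have le: "Leq R (T\<^sub>0 X) (T\<^sub>0 X) (FRel (MFun T) X X \<rho>) (graph_kernel R (T\<^sub>0 X) W (q \<cdot> a))"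
    using \<rho> em_fibre_iff[OF alg alg] by simp
  obtain c where c: "c \<in> hom (Base R) (T\<^sub>0 W) W" "q \<cdot> a = c \<cdot> T\<^sub>1 q"
    using quotient_arrow_of_factor[OF T_quotient_arrow_of[OF eq q] W qa le] by metis
  note etaX = eta_hom[OF X] and etaW = eta_hom[OF W] and muX = mu_hom[OF X] and muW = mu_hom[OF W]
  note Tc = T_hom[OF c(1)]
  have "(c \<cdot> \<eta> W) \<cdot> q = c \<cdot> (T\<^sub>1 q \<cdot> \<eta> X)"
    using base.Comp_assoc[OF qh etaW c(1)] eta_natural[OF qh] by simp
  also have "\<dots> = q \<cdot> (a \<cdot> \<eta> X)"
    using base.Comp_assoc[OF etaX Tqh c(1)] base.Comp_assoc[OF etaX a qh] c(2) by simp
  also have "\<dots> = Ide (Base R) W \<cdot> q"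
    using aD(3) base.Comp_Ide[OF qh] base.Ide_Comp[OF qh] by simp
  finally have unit: "c \<cdot> \<eta> W = Ide (Base R) W"
    by (rule quotient_arrow_epi[OF Q base.Comp_hom[OF etaW c(1)] base.Ide_hom[OF W]])
  have "(c \<cdot> \<mu> W) \<cdot> T\<^sub>1 (T\<^sub>1 q) = c \<cdot> (T\<^sub>1 q \<cdot> \<mu> X)"
    using base.Comp_assoc[OF T_hom[OF Tqh] muW c(1)] mu_natural[OF qh] by simp
  also have "\<dots> = q \<cdot> (a \<cdot> \<mu> X)"
    using base.Comp_assoc[OF muX Tqh c(1)] base.Comp_assoc[OF muX a qh] c(2) by simp
  also have "\<dots> = (c \<cdot> T\<^sub>1 q) \<cdot> T\<^sub>1 a"
    using aD(4) base.Comp_assoc[OF T_hom[OF a] a qh] c(2) by simp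
  also have "\<dots> = c \<cdot> T\<^sub>1 (q \<cdot> a)"
    using base.Comp_assoc[OF T_hom[OF a] Tqh c(1)] T_Comp[OF a qh] by simp
  also have "\<dots> = (c \<cdot> T\<^sub>1 c) \<cdot> T\<^sub>1 (T\<^sub>1 q)"
    using c(2) T_Comp[OF Tqh c(1)] base.Comp_assoc[OF T_hom[OF Tqh] Tc c(1)] by simp
  finally have "c \<cdot> \<mu> W = c \<cdot> T\<^sub>1 c"
    by (rule quotient_arrow_epi[OF TTQ base.Comp_hom[OF muW c(1)] base.Comp_hom[OF Tc c(1)]])
  then have "(W, c) \<in> em_algebras (Base R) T"
    using W c(1) unit by (simp add: em_algebras_def)
  then show thesis using that[of c] alg qh c(2) by (simp add: em_hom_iff)
qed

text \<open>A quotient arrow \<open>p\<close> of \<open>\<rho>\<close> in the base lifts to one of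
  algebras, so uniqueness yields an isomorphism of algebras through which \<open>q\<close> arises
  from \<open>p\<close>. Its underlying isomorphism carries the universal property of
  \<open>p\<close> in \<open>R\<close> over to \<open>q\<close>.\<close>

lemma em_quotient_arrow_ofD:
  assumes q: "quotient_arrow_of (em_doctrine R T) (X, a) \<rho> (Y, b) ((X, a), q, (Y, b))"
    and eq: "equivalence_relation (em_doctrine R T) (X, a) \<rho>"
  shows "quotient_arrow_of R X \<rho> Y q"
proof -
  have alg: "(X, a) \<in> em_algebras (Base R) T" and \<rho>: "\<rho> \<in> em_fibre R T (X, a) (X, a)"
    and eq': "equivalence_relation R X \<rho>"
    using eq by (auto simp: em_equivalence_iff)
  obtain W p where p: "quotient_arrow_of R X \<rho> W p"
    using quot eq' unfolding has_quotients_def by blast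
  obtain c where c: "((X, a), p, (W, c)) \<in> hom (em_category (Base R) T) (X, a) (W, c)"
    using quotient_algebra[OF alg \<rho> eq' p] .
  have p': "quotient_arrow_of (em_doctrine R T) (X, a) \<rho> (W, c) ((X, a), p, (W, c))"
    using em_quotient_arrow_ofI[OF p eq' c] .
  have cat: "category (Base (em_doctrine R T))" using em_category by simp
  obtain i j where inv: "inverse_arrows (em_category (Base R) T) (W, c) (Y, b) i j"
    and qi: "((X, a), q, (Y, b)) = Comp (em_category (Base R) T) i ((X, a), p, (W, c))"
    using quotient_arrow_of_unique[OF cat p' q] by (metis em_doctrine_simps(1))
  obtain i' where i': "i = ((W, c), i', (Y, b))" "i' \<in> hom (Base R) W Y"
    using em_homE inv unfolding inverse_arrows_def by metis
  obtain j' where j': "j = ((Y, b), j', (W, c))" "j' \<in> hom (Base R) Y W"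
    using em_homE inv unfolding inverse_arrows_def by metis
  have "inverse_arrows (Base R) W Y i' j'"
    using inv i' j' unfolding inverse_arrows_def by simp
  moreover have "q = i' \<cdot> p" using qi i' by simp
  ultimately show ?thesis using quotient_arrow_of_iso_comp[OF p] by simp
qed

lemma em_quotient_arrow_iff:
  assumes hom: "((X, a), q, (Y, b)) \<in> hom (em_category (Base R) T) (X, a) (Y, b)"
  shows "quotient_arrow (em_doctrine R T) (X, a) (Y, b) ((X, a), q, (Y, b)) \<longleftrightarrow>
    quotient_arrow R X Y q"
proof
  assume "quotient_arrow (em_doctrine R T) (X, a) (Y, b) ((X, a), q, (Y, b))"
  then show "quotient_arrow R X Y q"
    using em_quotient_arrow_ofD em_equivalence_iff unfolding quotient_arrow_def by metis
next
  assume "quotient_arrow R X Y q"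
  then have q: "quotient_arrow_of R X (graph_kernel R X Y q) Y q"
    using quotient_arrow_iff by simp
  \<comment> \<open>The kernel of \<open>q\<close> serves as the equivalence relation on the
    algebra, since it lies in the fibre over \<open>(X, a)\<close>.\<close>
  have eq: "equivalence_relation R X (graph_kernel R X Y q)"
    using equivalence_graph_kernel quotient_arrow_ofD(1)[OF q] .
  have "(X, a) \<in> em_algebras (Base R) T" using hom by (auto simp: em_hom_iff)
  then have "equivalence_relation (em_doctrine R T) (X, a) (graph_kernel R X Y q)"
    using eq em_graph_kernel_fibre[OF hom] by (simp add: em_equivalence_iff)
  then show "quotient_arrow (em_doctrine R T) (X, a) (Y, b) ((X, a), q, (Y, b))"
    using em_quotient_arrow_ofI[OF q eq hom] unfolding quotient_arrow_def by blast
qed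

section \<open>Free algebras and projectivity\<close>

lemma em_extension:
  assumes alg: "(X, a) \<in> em_algebras (Base R) T" and h: "h \<in> hom (Base R) P X"
  shows "((T\<^sub>0 P, \<mu> P), a \<cdot> T\<^sub>1 h, (X, a)) \<in> hom (em_category (Base R) T) (T\<^sub>0 P, \<mu> P) (X, a)"
proof -
  note aD = em_algebrasD[OF alg] and P = base.hom_Ob(1)[OF h]
  note X = aD(1) and a = aD(2) and Th = T_hom[OF h]
  have "(a \<cdot> T\<^sub>1 h) \<cdot> \<mu> P = (a \<cdot> \<mu> X) \<cdot> T\<^sub>1 (T\<^sub>1 h)"
    using base.Comp_assoc[OF mu_hom[OF P] Th a] mu_natural[OF h]
      base.Comp_assoc[OF T_hom[OF Th] mu_hom[OF X] a] by simp
  also have "\<dots> = a \<cdot> T\<^sub>1 (a \<cdot> T\<^sub>1 h)"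
    using aD(4) T_Comp[OF Th a] base.Comp_assoc[OF T_hom[OF Th] T_hom[OF a] a] by simp
  finally show ?thesis
    using alg free_algebra[OF P] base.Comp_hom[OF Th a] by (simp add: em_hom_iff)
qed

text \<open>\<open>a \<cdot> T\<^sub>1 h\<close> is the transpose of \<open>h\<close> under the
  free-forgetful adjunction. A homomorphism is the transpose of its restriction along the unit, by
  the homomorphism equation and the law \<open>\<mu> P \<cdot> T\<^sub>1 (\<eta> P) = Ide (Base R)
  (T\<^sub>0 P)\<close>.\<close>

lemma em_extension_unit:
  assumes P: "P \<in> Ob (Base R)"
    and hom: "((T\<^sub>0 P, \<mu> P), f, (X, a)) \<in> hom (em_category (Base R) T) (T\<^sub>0 P, \<mu> P) (X, a)"
  shows "a \<cdot> T\<^sub>1 (f \<cdot> \<eta> P) = f"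
proof -
  have alg: "(X, a) \<in> em_algebras (Base R) T" and f: "f \<in> hom (Base R) (T\<^sub>0 P) X"
    and eq: "f \<cdot> \<mu> P = a \<cdot> T\<^sub>1 f"
    using hom by (auto simp: em_hom_iff)
  note a = em_algebrasD(2)[OF alg] and Teta = T_hom[OF eta_hom[OF P]]
  have "a \<cdot> T\<^sub>1 (f \<cdot> \<eta> P) = (a \<cdot> T\<^sub>1 f) \<cdot> T\<^sub>1 (\<eta> P)"
    using T_Comp[OF eta_hom[OF P] f] base.Comp_assoc[OF Teta T_hom[OF f] a] by simp
  also have "\<dots> = f \<cdot> (\<mu> P \<cdot> T\<^sub>1 (\<eta> P))"
    using eq base.Comp_assoc[OF Teta mu_hom[OF P] f] by simp
  finally show ?thesis
    using rd_monad.right_unit[OF rd_monad P] base.Comp_Ide[OF f] by simp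
qed

lemma free_algebra_projective:
  assumes "projective R P"
  shows "projective (em_doctrine R T) (T\<^sub>0 P, \<mu> P)"
  unfolding projective_def em_doctrine_simps em_category_simps
proof (intro conjI allI impI)
  have P: "P \<in> Ob (Base R)" using assms by (simp add: projective_def)
  show "(T\<^sub>0 P, \<mu> P) \<in> em_algebras (Base R) T" by (rule free_algebra[OF P])
  fix A B f q
  assume f: "f \<in> hom (em_category (Base R) T) (T\<^sub>0 P, \<mu> P) B"
    and q: "quotient_arrow (em_doctrine R T) A B q"
  obtain X a Y b where AB: "A = (X, a)" "B = (Y, b)" by fastforce
  have qh: "q \<in> hom (em_category (Base R) T) (X, a) (Y, b)"
    using q AB by (auto simp: quotient_arrow_def dest: quotient_arrow_ofD)
  then obtain q' where q': "q = ((X, a), q', (Y, b))" "(X, a) \<in> em_algebras (Base R) T"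
    "(Y, b) \<in> em_algebras (Base R) T" "q' \<in> hom (Base R) X Y" "q' \<cdot> a = b \<cdot> T\<^sub>1 q'"
    using em_homE by metis
  obtain f' where f': "f = ((T\<^sub>0 P, \<mu> P), f', (Y, b))" "f' \<in> hom (Base R) (T\<^sub>0 P) Y"
    using em_homE f AB by metis
  have "quotient_arrow R X Y q'"
    using em_quotient_arrow_iff qh q q'(1) AB by simp
  \<comment> \<open>The lift is taken in the base, for the restriction of \<open>f'\<close> along
    the unit.\<close>
  then obtain h where h: "h \<in> hom (Base R) P X" "f' \<cdot> \<eta> P = q' \<cdot> h"
    using assms base.Comp_hom[OF eta_hom[OF P] f'(2)] unfolding projective_def by metis
  note a = em_algebrasD(2)[OF q'(2)] and b = em_algebrasD(2)[OF q'(3)] and Th = T_hom[OF h(1)]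
  \<comment> \<open>Since \<open>q'\<close> is a homomorphism, composing it with the extension of
    \<open>h\<close> gives the extension of \<open>q' \<cdot> h = f' \<cdot> \<eta> P\<close>, which
    is \<open>f'\<close>.\<close>
  have "q' \<cdot> (a \<cdot> T\<^sub>1 h) = b \<cdot> T\<^sub>1 (q' \<cdot> h)"
    using base.Comp_assoc[OF Th a q'(4)] q'(5) base.Comp_assoc[OF Th T_hom[OF q'(4)] b]
      T_Comp[OF h(1) q'(4)] by simp
  also have "\<dots> = f'" using em_extension_unit[OF P] f f'(1) AB(2) h(2) by metis
  finally have "f = Comp (em_category (Base R) T) q ((T\<^sub>0 P, \<mu> P), a \<cdot> T\<^sub>1 h, (X, a))"
    using f' q' by simp
  then show "\<exists>h\<in>hom (em_category (Base R) T) (T\<^sub>0 P, \<mu> P) A.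
      f = Comp (em_category (Base R) T) q h"
    using em_extension[OF q'(2) h(1)] AB by blast
qed

lemma em_cover:
  assumes alg: "(X, a) \<in> em_algebras (Base R) T" and p: "quotient_arrow R P X p"
  shows "quotient_arrow (em_doctrine R T) (T\<^sub>0 P, \<mu> P) (X, a) ((T\<^sub>0 P, \<mu> P), a \<cdot> T\<^sub>1 p, (X, a))"
proof -
  note aD = em_algebrasD[OF alg]
  have ph: "p \<in> hom (Base R) P X" using p by (auto simp: quotient_arrow_def dest: quotient_arrow_ofD)
  \<comment> \<open>The section \<open>\<eta> X\<close> of \<open>a\<close> is in general no
    homomorphism, so the argument runs in \<open>R\<close> and passes to algebras only at the
    end.\<close>
  have "quotient_arrow R (T\<^sub>0 X) X a"
    using split_epi_quotient_arrow[OF aD(2) eta_hom[OF aD(1)] aD(3)] .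
  then have "quotient_arrow R (T\<^sub>0 P) X (a \<cdot> T\<^sub>1 p)"
    using quotient_arrow_comp T_quotient_arrow[OF p] by blast
  then show ?thesis using em_quotient_arrow_iff[OF em_extension[OF alg ph]] by simp
qed

lemma em_projective_cover:
  assumes "projective_cover R \<G>"
  shows "projective_cover (em_doctrine R T) (free_algebras T \<G>)"
  unfolding projective_cover_def
proof (intro conjI ballI)
  have G: "\<G> \<subseteq> Ob (Base R)" "\<And>P. P \<in> \<G> \<Longrightarrow> projective R P"
    "\<And>X. X \<in> Ob (Base R) \<Longrightarrow> \<exists>P\<in>\<G>. \<exists>q. quotient_arrow R P X q"
    using assms by (auto simp: projective_cover_def)
  show "free_algebras T \<G> \<subseteq> Ob (Base (em_doctrine R T))"
    using G(1) free_algebra by (auto simp: free_algebras_def)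
  show "projective (em_doctrine R T) P" if "P \<in> free_algebras T \<G>" for P
    using that G(2) free_algebra_projective by (auto simp: free_algebras_def)
  fix A assume "A \<in> Ob (Base (em_doctrine R T))"
  then obtain X a where A: "A = (X, a)" "(X, a) \<in> em_algebras (Base R) T" by (cases A) auto
  obtain P p where "P \<in> \<G>" "quotient_arrow R P X p"
    using G(3)[OF em_algebrasD(1)[OF A(2)]] by blast
  then show "\<exists>P\<in>free_algebras T \<G>. \<exists>q. quotient_arrow (em_doctrine R T) P A q"
    using em_cover[OF A(2)] A(1) unfolding free_algebras_def by blast
qed

end

section \<open>The identity monad\<close>

definition id_monad :: "('o, 'm, 'r) doctrine \<Rightarrow> ('o, 'm, 'r) monad_data" where
  "id_monad R = \<lparr>MFun = arrow1_id, Unit = Ide (Base R), Mult = Ide (Base R)\<rparr>"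

lemma id_monad_simps [simp]:
  "FOb (MFun (id_monad R)) X = X" "FAr (MFun (id_monad R)) f = f"
  "Unit (id_monad R) = Ide (Base R)" "Mult (id_monad R) = Ide (Base R)"
  by (simp_all add: id_monad_def arrow1_id_def)

context extensional_doctrine_with_quotients
begin

lemma two_arrow_id: "two_arrow R R arrow1_id arrow1_id (Ide (Base R))"
  by unfold_locales
    (auto simp: arrow1_id_def is_functor_def base.Ide_hom base.Comp_Ide base.Ide_Comp Reidx_Ide
      Leq_refl)

lemma eqrd_monad_id: "eqrd_monad R (id_monad R)"
proof -
  \<comment> \<open>This lets \<open>two_arrow_id\<close> serve for the multiplication as well as
    for the unit.\<close>
  have "arrow1_comp arrow1_id arrow1_id = (arrow1_id :: ('a, 'b, 'c, 'a, 'b, 'c) arrow1)"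
    by (simp add: arrow1_comp_def arrow1_id_def)
  then have "rd_monad R (id_monad R)"
    using two_arrow_id
    by (simp add: rd_monad_def rd_monad_axioms_def base.Comp_Ide[OF base.Ide_hom])
      (simp add: id_monad_def)
  then show ?thesis
    using relational_doctrine_axioms ext quot
    by (simp add: eqrd_monad_def eqrd_object_def preserves_quotients_def id_monad_def arrow1_id_def)
qed

text \<open>When the unit consists of identities, the unit law of an algebra forces its structure
  map to be the identity.\<close>

lemma em_algebras_id:
  "(X, a) \<in> em_algebras (Base R) (id_monad R) \<longleftrightarrow> X \<in> Ob (Base R) \<and> a = Ide (Base R) X"
  using base.Comp_Ide[of a X X] base.Ide_hom[of X] by (auto simp: em_algebras_def)

lemma free_algebras_id: "free_algebras (id_monad R) \<G> = (\<lambda>X. (X, Ide (Base R) X)) ` \<G>"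
  by (auto simp: free_algebras_def)

lemma em_hom_id:
  "((X, Ide (Base R) X), f, (Y, Ide (Base R) Y)) \<in>
      hom (em_category (Base R) (id_monad R)) (X, Ide (Base R) X) (Y, Ide (Base R) Y) \<longleftrightarrow>
    f \<in> hom (Base R) X Y"
  using base.hom_Ob[of f X Y] base.Comp_Ide[of f X Y] base.Ide_Comp[of f X Y]
  by (auto simp: em_hom_iff em_algebras_id)

text \<open>\<open>X \<mapsto> (X, Ide (Base R) X)\<close> identifies the base of \<open>R\<close>
  with the category of algebras for the identity monad. \<open>em_quotient_arrow_iff\<close> matches
  the quotient arrows, so liftings and covers correspond.\<close>

lemma projective_cover_id:
  assumes cover: "projective_cover (em_doctrine R (id_monad R)) (free_algebras (id_monad R) \<G>)"
    and G: "\<G> \<subseteq> Ob (Base R)"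
  shows "projective_cover R \<G>"
  unfolding projective_cover_def
proof (intro conjI ballI G)
  interpret M: monad_with_quotients R "id_monad R"
    by unfold_locales (rule eqrd_monad_id)
  let ?E = "em_doctrine R (id_monad R)" and ?C = "em_category (Base R) (id_monad R)"
  let ?A = "\<lambda>X. (X, Ide (Base R) X)"
  {
    fix P assume P: "P \<in> \<G>"
    show "projective R P"
      unfolding projective_def
    proof (intro conjI allI impI)
      show "P \<in> Ob (Base R)" using P G by blast
      fix X Y f q
      assume f: "f \<in> hom (Base R) P Y" and q: "quotient_arrow R X Y q"
      have qh: "q \<in> hom (Base R) X Y"
        using q by (auto simp: quotient_arrow_def dest: quotient_arrow_ofD)
      \<comment> \<open>The lifting problem is posed for algebras with identity structure maps and
        solved there; the underlying arrow of the solution is the lift in \<open>R\<close>.\<close>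
      have "quotient_arrow ?E (?A X) (?A Y) (?A X, q, ?A Y)"
        using M.em_quotient_arrow_iff qh q em_hom_id by blast
      moreover have "(?A P, f, ?A Y) \<in> hom (Base ?E) (?A P) (?A Y)"
        using f em_hom_id by simp
      moreover have "projective ?E (?A P)"
        using cover P by (simp add: projective_cover_def free_algebras_id)
      ultimately obtain h where h: "h \<in> hom ?C (?A P) (?A X)"
        "(?A P, f, ?A Y) = Comp ?C (?A X, q, ?A Y) h"
        unfolding projective_def em_doctrine_simps by meson
      then obtain h' where "h = (?A P, h', ?A X)" "h' \<in> hom (Base R) P X"
        using em_homE by metis
      then show "\<exists>h\<in>hom (Base R) P X. f = q \<cdot> h" using h(2) by auto
    qed
  }
  fix X assume X: "X \<in> Ob (Base R)"
  then have "?A X \<in> Ob (Base ?E)" by (simp add: em_algebras_id)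
  then obtain P q where P: "P \<in> \<G>" and q: "quotient_arrow ?E (?A P) (?A X) q"
    using cover unfolding projective_cover_def free_algebras_id by blast
  have qh: "q \<in> hom ?C (?A P) (?A X)"
    using q by (auto simp: quotient_arrow_def dest: quotient_arrow_ofD)
  then obtain q' where q': "q = (?A P, q', ?A X)"
    using em_homE by metis
  then have "quotient_arrow R P X q'"
    using M.em_quotient_arrow_iff qh q by blast
  then show "\<exists>P\<in>\<G>. \<exists>q. quotient_arrow R P X q" using P by blast
qed

end

theorem theorem4p4:
  fixes R :: "('o, 'm, 'r) doctrine" and \<G> :: "'o set"
  assumes "relational_doctrine R" and "extensional R" and "has_quotients R"
    and "\<G> \<subseteq> Ob (Base R)"
  shows "projective_cover R \<G> \<longleftrightarrow>
    (\<forall>T :: ('o, 'm, 'r) monad_data. eqrd_monad R T \<longrightarrow>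
      projective_cover (em_doctrine R T) (free_algebras T \<G>))"
proof -
  interpret extensional_doctrine_with_quotients R
    using assms
    by (simp add: extensional_doctrine_with_quotients_def
        extensional_doctrine_with_quotients_axioms_def)
  have "projective_cover (em_doctrine R T) (free_algebras T \<G>)"
    if "projective_cover R \<G>" "eqrd_monad R T" for T :: "('o, 'm, 'r) monad_data"
  proof -
    interpret monad_with_quotients R T by unfold_locales (rule that(2))
    show ?thesis using em_projective_cover that(1) .
  qed
  then show ?thesis using projective_cover_id[OF _ assms(4)] eqrd_monad_id by blast
qed

end
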